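(* Let $f:\mathbb R^d\to\mathbb R$ be $\hat L_{\mathbf S}$-relatively smooth in subspaces $\mathbf S$, $\hat\mu$-relatively convex, and $L_{\mathbf S}$-self-concordant in the range of $\mathbf S$, for sketches $\mathbf S\sim\mathcal D$. Let the sampling $\mathbf S\sim\mathcal D$ satisfy, for all $x$, $\mathrm{Null}(\mathbf S^\top\nabla^2 f(x)\mathbf S)=\mathrm{Null}(\mathbf S)$ and $\mathrm{Range}(\nabla^2 f(x))\subset\mathrm{Range}\left(\mathbb E_{\mathbf S\sim\mathcal D}[\mathbf S\mathbf S^\top]\right)$. Choose the parameter $L_{\text{alg}}=\sup_{\mathbf S\sim\mathcal D}\frac92L_{\mathbf S}\hat L_{\mathbf S}^2$ in SGN, and let $\rho=\min_{x\in\mathcal Q(x^0)}\rho(x)$ (defined in the context). Then $0<\rho\le1$. Moreover, while the iterates $x^0,\dots,x^k$ of SGN satisfy $\|\nabla_{\mathbf S_t}f(x^t)\|^*_{x^t,\mathbf S_t}\ge\frac1{L_{\mathbf S_t}}$ (for all $t=0,\dots,k$), SGN has the decrease $$\mathbb E\left[f(x^k)-f^*\right]\le\left(1-\tfrac43\rho\hat\mu\right)^k(f(x^0)-f^* ),$$ and hence global linear $\mathcal O\left(\frac1{\rho\hat\mu}\log\frac1\varepsilon\right)$ convergence, i.e. in this regime $\mathcal O\left(\frac1{\rho\hat\mu}\log\frac1\varepsilon\right)$ iterations suffice for $\mathbb E[f(x^k)-f^*]\le\varepsilon(f(x^0)-f^* )$.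
   Context: Throughout, $f:\mathbb R^d\to\mathbb R$ is convex, three times differentiable with positive definite Hessian, bounded from below, with minimizer $x^*$ and $f^*=f(x^* )$. Local norms: $\|h\|_x=\langle\nabla^2 f(x)h,h\rangle^{1/2}$, $\|g\|_x^*=\langle g,\nabla^2 f(x)^{-1}g\rangle^{1/2}$. For $\mathbf S\in\mathbb R^{d\times\tau(\mathbf S)}$: $\nabla_{\mathbf S}f(x)=\mathbf S^\top\nabla f(x)$, $\nabla^2_{\mathbf S}f(x)=\mathbf S^\top\nabla^2 f(x)\mathbf S$, $\|h\|_{x,\mathbf S}=\langle\nabla^2_{\mathbf S}f(x)h,h\rangle^{1/2}$, $\|g\|^*_{x,\mathbf S}=\langle g,[\nabla^2_{\mathbf S}f(x)]^\dagger g\rangle^{1/2}$ ($\dagger$ is the Moore–Penrose pseudoinverse), $\mathbf P_x=\mathbf S(\mathbf S^\top\nabla^2 f(x)\mathbf S)^\dagger\mathbf S^\top\nabla^2 f(x)$. Relative convexity with constant $\hat\mu>0$: $f(y)\ge f(x)+\langle\nabla f(x),y-x\rangle+\frac{\hat\mu}2\|y-x\|_x^2$ for all $x,y\in\mathbb R^d$. Relative smoothness in subspace $\mathbf S$ with constant $\hat L_{\mathbf S}>0$: $f(x+\mathbf Sh)\le f(x)+\langle\nabla_{\mathbf S}f(x),h\rangle+\frac{\hat L_{\mathbf S}}2\|h\|_{x,\mathbf S}^2$ for all $x\in\mathbb R^d$, $h\in\mathbb R^{\tau(\mathbf S)}$. $f$ is $L_{\mathbf S}$-self-concordant in the range of $\mathbf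 S$ if $|\nabla^3f(x)[\mathbf Sh,\mathbf Sh,\mathbf Sh]|\le L_{\mathbf S}\|\mathbf Sh\|_x^3$ for all $x\in\mathbb R^d$, $h\in\mathbb R^{\tau(\mathbf S)}\setminus\{0\}$; here $0<L_{\mathbf S}<\infty$. The supremum defining $L_{\text{alg}}$ is assumed finite; it is over $\mathbf S$ in the support of $\mathcal D$. SGN (Sketchy Global Newton): given $x^0\in\mathbb R^d$ and $L_{\text{alg}}>0$, for $k=0,1,2,\dots$ sample $\mathbf S_k\sim\mathcal D$ (independently of the past) and set $x^{k+1}=x^k-\alpha_k\mathbf S_k[\nabla^2_{\mathbf S_k}f(x^k)]^\dagger\nabla_{\mathbf S_k}f(x^k)$ with $\alpha_k=\alpha(x^k,\mathbf S_k)$, where $\alpha(x,\mathbf S)=\frac{-1+\sqrt{1+2G}}{G}$, $G=L_{\text{alg}}\|\nabla_{\mathbf S}f(x)\|^*_{x,\mathbf S}$ (and $\alpha=1$ if $G=0$). Conditioning: $\mathcal Q(x^0)=\{x: f(x)\le f(x^0)\}$ and $$\rho(x)=\min_{g\in\mathbb R^d\setminus\{0\}}\frac{g^\top\,\mathbb E_{\mathbf S\sim\mathcal D}[\alpha(x,\mathbf S)\mathbf P_x]\,[\nabla^2 f(x)]^\dagger g}{\|g\|_x^{*2}}.$$ Conditions on the iterates are understood to hold almost surely. *)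

theory Defs
  imports
    "HOL-Analysis.Analysis"
    "HOL-Probability.Probability"
    "Jordan_Normal_Form.Matrix_Kernel"
begin

no_notation vec_index (infixl "$" 100)
no_notation scalar_prod (infix "\<bullet>" 70)

section \<open>Derivatives and local norms\<close>

definition grad :: "(real^'d \<Rightarrow> real) \<Rightarrow> real^'d \<Rightarrow> real^'d" where
  "grad f x = (THE g. GDERIV f x :> g)"

definition hess :: "(real^'d \<Rightarrow> real) \<Rightarrow> real^'d \<Rightarrow> real^'d^'d" where
  "hess f x = matrix (frechet_derivative (grad f) (at x))"

text \<open>The third derivative as a cubic form, \<open>h \<mapsto> D\<^sup>3 f(x)[h, h, h]\<close>.\<close>

definition third_deriv :: "(real^'d \<Rightarrow> real) \<Rightarrow> real^'d \<Rightarrow> real^'d \<Rightarrow> real" where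
  "third_deriv f x h = (frechet_derivative (hess f) (at x) h *v h) \<bullet> h"

definition three_times_differentiable :: "(real^'d \<Rightarrow> real) \<Rightarrow> bool" where
  "three_times_differentiable f \<longleftrightarrow>
     (\<forall>x. f differentiable (at x) \<and> grad f differentiable (at x) \<and> hess f differentiable (at x))"

definition pos_def :: "real^'d^'d \<Rightarrow> bool" where
  "pos_def A \<longleftrightarrow> transpose A = A \<and> (\<forall>h. h \<noteq> 0 \<longrightarrow> 0 < (A *v h) \<bullet> h)"

definition local_norm :: "(real^'d \<Rightarrow> real) \<Rightarrow> real^'d \<Rightarrow> real^'d \<Rightarrow> real" where
  "local_norm f x h = sqrt ((hess f x *v h) \<bullet> h)"

definition local_dual_norm :: "(real^'d \<Rightarrow> real) \<Rightarrow> real^'d \<Rightarrow> real^'d \<Rightarrow> real" where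
  "local_dual_norm f x g = sqrt (g \<bullet> (matrix_inv (hess f x) *v g))"

section \<open>Moore--Penrose pseudoinverse\<close>

text \<open>
  It is needed twice: for matrices over a finite index type, and for the sketched Hessians, whose
  size varies with the sketch and which therefore are matrices with explicit dimensions.
\<close>

definition pinv_type :: "real^'n^'m \<Rightarrow> real^'m^'n" where
  "pinv_type A = (THE X. A ** X ** A = A \<and> X ** A ** X = X \<and>
     transpose (A ** X) = A ** X \<and> transpose (X ** A) = X ** A)"

definition pinv :: "real mat \<Rightarrow> real mat" where
  "pinv A = (THE X. X \<in> carrier_mat (dim_col A) (dim_row A) \<and>
     A * X * A = A \<and> X * A * X = X \<and>
     transpose_mat (A * X) = A * X \<and> transpose_mat (X * A) = X * A)"

section \<open>Sketches\<close>

text \<open>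
  A real matrix with \<open>d\<close> rows and an arbitrary number \<open>n\<close> of columns is the pair of \<open>n\<close> and the
  sequence of its columns, continued by zero. On the set of these pairs, the product topology is
  that of the disjoint union over \<open>n\<close> of the Euclidean spaces of matrices with \<open>n\<close> columns.
  Vectors of the sketched space (of varying dimension \<open>n\<close>) have explicit dimension.
\<close>

type_synonym 'd sketch = "nat \<times> (nat \<Rightarrow> real^'d)"

definition sketches :: "('d::finite) sketch set" where
  "sketches = {S. \<forall>j\<ge>fst S. snd S j = 0}"

abbreviation sk_dim :: "('d::finite) sketch \<Rightarrow> nat" where
  "sk_dim S \<equiv> fst S"

abbreviation sk_col :: "'d sketch \<Rightarrow> nat \<Rightarrow> real^'d" where
  "sk_col S j \<equiv> snd S j"

text \<open>The maps \<open>h \<mapsto> S h\<close> and \<open>g \<mapsto> S\<^sup>T g\<close>, and the matrix \<open>S S\<^sup>T\<close>.\<close>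

definition sk_mult :: "'d sketch \<Rightarrow> real Matrix.vec \<Rightarrow> real^'d" where
  "sk_mult S h = (\<Sum>j<sk_dim S. vec_index h j *\<^sub>R sk_col S j)"

definition sk_transp :: "'d sketch \<Rightarrow> real^'d \<Rightarrow> real Matrix.vec" where
  "sk_transp S g = Matrix.vec (sk_dim S) (\<lambda>j. sk_col S j \<bullet> g)"

definition sk_outer :: "'d sketch \<Rightarrow> real^'d^'d" where
  "sk_outer S = matrix (\<lambda>v. sk_mult S (sk_transp S v))"

definition sk_null :: "('d::finite) sketch \<Rightarrow> real Matrix.vec set" where
  "sk_null S = {h \<in> carrier_vec (sk_dim S). sk_mult S h = 0}"

definition sk_grad :: "(real^'d \<Rightarrow> real) \<Rightarrow> 'd sketch \<Rightarrow> real^'d \<Rightarrow> real Matrix.vec" where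
  "sk_grad f S x = sk_transp S (grad f x)"

definition sk_hess :: "(real^'d \<Rightarrow> real) \<Rightarrow> 'd sketch \<Rightarrow> real^'d \<Rightarrow> real mat" where
  "sk_hess f S x = Matrix.mat (sk_dim S) (sk_dim S)
     (\<lambda>(i, j). sk_col S i \<bullet> (hess f x *v sk_col S j))"

definition sk_norm :: "(real^'d \<Rightarrow> real) \<Rightarrow> 'd sketch \<Rightarrow> real^'d \<Rightarrow> real Matrix.vec \<Rightarrow> real" where
  "sk_norm f S x h = sqrt (scalar_prod (sk_hess f S x *\<^sub>v h) h)"

definition sk_dual_norm :: "(real^'d \<Rightarrow> real) \<Rightarrow> 'd sketch \<Rightarrow> real^'d \<Rightarrow> real Matrix.vec \<Rightarrow> real" where
  "sk_dual_norm f S x g = sqrt (scalar_prod g (pinv (sk_hess f S x) *\<^sub>v g))"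

text \<open>\<open>P\<^sub>x = S (S\<^sup>T H S)\<^sup>\<dagger> S\<^sup>T H\<close>, where \<open>H\<close> is the Hessian at \<open>x\<close>.\<close>

definition sk_proj :: "(real^'d \<Rightarrow> real) \<Rightarrow> 'd sketch \<Rightarrow> real^'d \<Rightarrow> real^'d^'d" where
  "sk_proj f S x =
     matrix (\<lambda>v. sk_mult S (pinv (sk_hess f S x) *\<^sub>v sk_transp S (hess f x *v v)))"

definition sk_support :: "('d::finite) sketch measure \<Rightarrow> 'd sketch set" where
  "sk_support D = {S. \<forall>U. open U \<and> S \<in> U \<longrightarrow> 0 < emeasure D U}"

section \<open>Function classes\<close>

definition relatively_convex :: "(real^'d \<Rightarrow> real) \<Rightarrow> real \<Rightarrow> bool" where
  "relatively_convex f \<mu> \<longleftrightarrow> 0 < \<mu> \<and>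
     (\<forall>x y. f y \<ge> f x + grad f x \<bullet> (y - x) + \<mu> / 2 * (local_norm f x (y - x))\<^sup>2)"

definition relatively_smooth_in :: "(real^'d \<Rightarrow> real) \<Rightarrow> 'd sketch \<Rightarrow> real \<Rightarrow> bool" where
  "relatively_smooth_in f S L \<longleftrightarrow> 0 < L \<and>
     (\<forall>x. \<forall>h \<in> carrier_vec (sk_dim S).
        f (x + sk_mult S h) \<le> f x + scalar_prod (sk_grad f S x) h + L / 2 * (sk_norm f S x h)\<^sup>2)"

definition self_concordant_in :: "(real^'d \<Rightarrow> real) \<Rightarrow> 'd sketch \<Rightarrow> real \<Rightarrow> bool" where
  "self_concordant_in f S L \<longleftrightarrow> 0 < L \<and>
     (\<forall>x. \<forall>h \<in> carrier_vec (sk_dim S) - {0\<^sub>v (sk_dim S)}.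
        \<bar>third_deriv f x (sk_mult S h)\<bar> \<le> L * (local_norm f x (sk_mult S h)) ^ 3)"

section \<open>Sketchy Global Newton\<close>

definition sgn_stepsize :: "real \<Rightarrow> (real^'d \<Rightarrow> real) \<Rightarrow> real^'d \<Rightarrow> 'd sketch \<Rightarrow> real" where
  "sgn_stepsize L f x S =
     (let G = L * sk_dual_norm f S x (sk_grad f S x)
      in if G = 0 then 1 else (- 1 + sqrt (1 + 2 * G)) / G)"

definition sgn_step :: "real \<Rightarrow> (real^'d \<Rightarrow> real) \<Rightarrow> real^'d \<Rightarrow> 'd sketch \<Rightarrow> real^'d" where
  "sgn_step L f x S =
     x - sgn_stepsize L f x S *\<^sub>R sk_mult S (pinv (sk_hess f S x) *\<^sub>v sk_grad f S x)"

primrec sgn_iter ::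
  "real \<Rightarrow> (real^'d \<Rightarrow> real) \<Rightarrow> real^'d \<Rightarrow> (nat \<Rightarrow> 'd sketch) \<Rightarrow> nat \<Rightarrow> real^'d" where
  "sgn_iter L f x0 s 0 = x0"
| "sgn_iter L f x0 s (Suc k) = sgn_step L f (sgn_iter L f x0 s k) (s k)"

section \<open>Conditioning\<close>

definition level_set :: "(real^'d \<Rightarrow> real) \<Rightarrow> real^'d \<Rightarrow> (real^'d) set" where
  "level_set f x0 = {x. f x \<le> f x0}"

text \<open>
  Both minima are genuine minima (least elements); nothing can be proved about \<open>LEAST\<close> unless
  the minimum is attained.
\<close>

definition rho_at :: "real \<Rightarrow> (real^'d \<Rightarrow> real) \<Rightarrow> 'd sketch measure \<Rightarrow> real^'d \<Rightarrow> real" where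
  "rho_at L f D x =
     (LEAST r. \<exists>g. g \<noteq> 0 \<and>
        r = (g \<bullet> ((integral\<^sup>L D (\<lambda>S. sgn_stepsize L f x S *\<^sub>R sk_proj f S x)
                    ** pinv_type (hess f x)) *v g))
            / (local_dual_norm f x g)\<^sup>2)"

definition rho_min :: "real \<Rightarrow> (real^'d \<Rightarrow> real) \<Rightarrow> 'd sketch measure \<Rightarrow> real^'d \<Rightarrow> real" where
  "rho_min L f D x0 = (LEAST r. \<exists>x \<in> level_set f x0. r = rho_at L f D x)"

end

theory Submission
  imports Defs
begin

text \<open>
  Let \<open>g\<close> be the gradient and \<open>H\<close> the Hessian at \<open>x\<close>. The sketched Newton direction
  \<open>u = S (S\<^sup>T H S)\<^sup>\<dagger> S\<^sup>T g\<close> is the Galerkin solution of \<open>H u = g\<close> in the range of \<open>S\<close>: it lies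
  in that range and \<open>\<langle>H u, v\<rangle> = \<langle>g, v\<rangle>\<close> for all \<open>v\<close> in it (\<open>sk_mult_pinv_transp\<close>). Its energy
  \<open>\<langle>g, u\<rangle>\<close> is the squared sketched dual norm of the gradient. The full dual norm is the same quantity
  for the whole space.

  One step decreases \<open>f\<close> by at least \<open>2 / 3 \<alpha> \<langle>g, u\<rangle>\<close> as long as the sketched gradient is
  large (\<open>sgn_step_decrease\<close>). In expectation over the sketch this is \<open>2 / 3\<close> of the numerator in the
  definition of \<open>\<rho>(x)\<close>, so it is at least \<open>2 / 3 \<rho>\<close> times the squared dual norm of the gradient; by
  relative convexity the latter is at least \<open>2 \<mu>\<close> times the gap \<open>f x - f xstar\<close>
  (\<open>relatively_convex_gap\<close>). The expected gap therefore contracts by the factor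
  \<open>1 - 4 / 3 \<rho> \<mu>\<close> (\<open>expected_gap\<close>), which is iterated in \<open>linear_contraction_bound\<close>.

  That \<open>\<rho>\<close> is a minimum, hence positive, is a compactness statement
  (\<open>energy_ratio_attains_min\<close>). Relative convexity makes level sets compact. For a fixed sketch the
  energy is jointly continuous in the point and the direction, by a perturbation estimate for Galerkin
  solutions (\<open>sol_perturbation\<close>), and dominated convergence transfers this to the mean. Positivity of
  the mean for every direction comes from the range condition (\<open>mean_energy_pos\<close>), and \<open>\<rho> \<le> 1\<close>
  holds because the energy grows with the subspace and step sizes are at most \<open>1\<close>.

  All measurability rests on the variational formula for the energy, a supremum of
  functions of \<open>S S\<^sup>T\<close> (\<open>borel_measurable_energy\<close>).
\<close>

(* The unqualified names below are those of real vector spaces. *)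
hide_const (open) VectorSpace.subspace LinearCombinations.module.span VectorSpace.vectorspace.dim
  Matrix.orthogonal

section \<open>Galerkin solutions on a subspace\<close>

lemma inner_symmetric_matrix:
  fixes H :: "real^'n^'n"
  assumes "transpose H = H"
  shows "(H *v x) \<bullet> y = x \<bullet> (H *v y)"
  by (metis assms dot_lmul_matrix transpose_matrix_vector)

text \<open>
  The Galerkin problem for a symmetric form \<open>H\<close> that is positive definite on a subspace \<open>V\<close>: find
  \<open>u \<in> V\<close> with \<open>\<langle>H u, v\<rangle> = \<langle>g, v\<rangle>\<close> for all \<open>v \<in> V\<close>. Definiteness is asked on \<open>V\<close> only, because the
  locale is also used for \<open>H = S S\<^sup>T\<close>, which is degenerate off the range of \<open>S\<close>.
\<close>

locale galerkin =
  fixes H :: "real^'n^'n" and V :: "(real^'n) set"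
  assumes subspace_V: "subspace V"
    and sym: "transpose H = H"
    and pos: "\<And>v. v \<in> V \<Longrightarrow> v \<noteq> 0 \<Longrightarrow> 0 < (H *v v) \<bullet> v"
begin

definition sol :: "real^'n \<Rightarrow> real^'n" where
  "sol g = (THE u. u \<in> V \<and> (\<forall>v\<in>V. (H *v u) \<bullet> v = g \<bullet> v))"

lemma nonneg: "v \<in> V \<Longrightarrow> 0 \<le> (H *v v) \<bullet> v"
  using pos[of v] by (cases "v = 0") auto

lemma solution_unique:
  assumes "u \<in> V" "\<forall>v\<in>V. (H *v u) \<bullet> v = g \<bullet> v"
    and "u' \<in> V" "\<forall>v\<in>V. (H *v u') \<bullet> v = g \<bullet> v"
  shows "u = u'"
proof -
  have V: "u - u' \<in> V" using assms subspace_V by (simp add: subspace_diff)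
  then have "(H *v (u - u')) \<bullet> (u - u') = 0"
    using assms by (simp add: matrix_vector_mult_diff_distrib inner_diff_left)
  with pos[OF V] show ?thesis by force
qed

text \<open>
  By definiteness \<open>H\<close> is injective on \<open>V\<close> and \<open>H V\<close> meets the orthogonal complement of \<open>V\<close> only
  in \<open>0\<close>. The dimensions of the two subspaces add up to that of the whole space, so they span it, and
  the component of \<open>g\<close> in \<open>H V\<close> gives the solution.
\<close>

lemma solution_exists: "\<exists>u\<in>V. \<forall>v\<in>V. (H *v u) \<bullet> v = g \<bullet> v"
proof -
  let ?W = "(*v) H ` V" and ?V' = "{y \<in> UNIV. \<forall>x\<in>V. orthogonal x y}"
  note orth = Linear_Algebra.orthogonal_def
  have lin: "linear ((*v) H)" by (rule matrix_vector_mul_linear)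
  have sW: "subspace ?W" by (rule linear_subspace_image[OF lin subspace_V])
  have sV': "subspace ?V'" by (simp add: subspace_orthogonal_to_vectors)
  have "inj_on ((*v) H) V"
  proof (rule inj_onI)
    fix a b assume ab: "a \<in> V" "b \<in> V" "H *v a = H *v b"
    then have V: "a - b \<in> V" using subspace_V by (simp add: subspace_diff)
    have "(H *v (a - b)) \<bullet> (a - b) = 0"
      using ab by (simp add: matrix_vector_mult_diff_distrib)
    then show "a = b" using pos[OF V] by auto
  qed
  then have dW: "dim ?W = dim V"
    using subspace_V lin by (simp add: dim_image_eq span_eq_iff[THEN iffD2])
  have "?W \<inter> ?V' \<subseteq> {0}"
  proof
    fix y assume "y \<in> ?W \<inter> ?V'"
    then obtain v where v: "v \<in> V" "y = H *v v" "orthogonal v y" by auto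
    then have "(H *v v) \<bullet> v = 0" by (metis orth inner_commute)
    then have "v = 0" using pos[OF v(1)] by auto
    with v(2) show "y \<in> {0}" by simp
  qed
  moreover have "0 \<in> ?W \<inter> ?V'" by (simp add: subspace_0[OF sW] subspace_0[OF sV', simplified])
  ultimately have int: "?W \<inter> ?V' = {0}" by blast
  have "dim {x + y |x y. x \<in> ?W \<and> y \<in> ?V'} + dim (?W \<inter> ?V') = dim ?W + dim ?V'"
    by (rule dim_sums_Int[OF sW sV'])
  then have "dim {x + y |x y. x \<in> ?W \<and> y \<in> ?V'} = dim ?V' + dim V"
    using int dW by simp
  also have "\<dots> = DIM(real^'n)"
    using dim_subspace_orthogonal_to_vectors[OF subspace_V subspace_UNIV] by simp
  finally have full: "span {x + y |x y. x \<in> ?W \<and> y \<in> ?V'} = UNIV"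
    using dim_eq_full by blast
  have "span {x + y |x y. x \<in> ?W \<and> y \<in> ?V'} = {x + y |x y. x \<in> ?W \<and> y \<in> ?V'}"
    by (rule span_eq_iff[THEN iffD2], rule subspace_sums[OF sW sV'])
  then have "{x + y |x y. x \<in> ?W \<and> y \<in> ?V'} = UNIV" by (simp only: full)
  then have "g \<in> {x + y |x y. x \<in> ?W \<and> y \<in> ?V'}" by simp
  then obtain x y where x: "x \<in> ?W" and y': "y \<in> ?V'" and gxy: "g = x + y" by blast
  from x obtain u where u: "u \<in> V" and xu: "x = H *v u" by blast
  have g: "g = H *v u + y" by (simp only: gxy xu)
  have y: "\<forall>x\<in>V. orthogonal x y" using y' by simp
  have "(H *v u) \<bullet> v = g \<bullet> v" if "v \<in> V" for v
  proof -
    have "y \<bullet> v = 0" using y that by (metis orth inner_commute)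
    then show ?thesis unfolding g by (simp add: inner_add_left)
  qed
  then show ?thesis by (intro bexI[OF _ u] ballI)
qed

lemma sol_works: "sol g \<in> V \<and> (\<forall>v\<in>V. (H *v sol g) \<bullet> v = g \<bullet> v)"
  unfolding sol_def
  by (rule theI') (use solution_exists[of g] solution_unique in blast)

lemma sol_in: "sol g \<in> V"
  and sol_eq: "v \<in> V \<Longrightarrow> (H *v sol g) \<bullet> v = g \<bullet> v"
  using sol_works by auto

lemma solI: "u \<in> V \<Longrightarrow> (\<And>v. v \<in> V \<Longrightarrow> (H *v u) \<bullet> v = g \<bullet> v) \<Longrightarrow> sol g = u"
  using solution_unique[of "sol g" g u] sol_works by blast

lemma linear_sol: "linear sol"
proof (rule linearI)
  show "sol (a + b) = sol a + sol b" for a b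
    using subspace_V by (intro solI)
      (auto simp: sol_in sol_eq subspace_add matrix_vector_right_distrib inner_add_left)
  show "sol (c *\<^sub>R a) = c *\<^sub>R sol a" for c a
    using subspace_V by (intro solI)
      (auto simp: sol_in sol_eq subspace_scale matrix_vector_mult_scaleR)
qed

lemma sol_form: "v \<in> V \<Longrightarrow> sol (H *v v) = v"
  by (rule solI) auto

lemma sol_symmetric: "sol g \<bullet> h = g \<bullet> sol h"
proof -
  have "sol g \<bullet> h = (H *v sol h) \<bullet> sol g" using sol_eq[OF sol_in] by (simp add: inner_commute)
  also have "\<dots> = (H *v sol g) \<bullet> sol h"
    using inner_symmetric_matrix[OF sym, of "sol h" "sol g"] by (simp add: inner_commute)
  finally show ?thesis using sol_eq[OF sol_in] by simp
qed

lemma energy: "(H *v sol g) \<bullet> sol g = g \<bullet> sol g"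
  by (rule sol_eq[OF sol_in])

lemma energy_nonneg: "0 \<le> g \<bullet> sol g"
  using nonneg[OF sol_in, of g] by (simp add: energy)

lemma energy_zeroD:
  assumes "g \<bullet> sol g = 0" "v \<in> V" shows "g \<bullet> v = 0"
proof -
  have "sol g = 0" using pos[OF sol_in, of g] assms(1) by (force simp: energy)
  then show ?thesis using sol_eq[OF assms(2), of g] by simp
qed

text \<open>
  The energy \<open>\<langle>g, u\<rangle>\<close> of the solution \<open>u\<close> is the maximum over \<open>w \<in> V\<close> of
  \<open>2 \<langle>g, w\<rangle> - \<langle>H w, w\<rangle>\<close>, attained at \<open>w = u\<close>. This describes the sketched dual norm without a
  pseudoinverse; monotonicity in \<open>V\<close>, measurability and the gap estimate below all come from it.
\<close>

lemma energy_dual: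
  assumes w: "w \<in> V"
  shows "2 * (g \<bullet> w) - (H *v w) \<bullet> w \<le> g \<bullet> sol g"
proof -
  have "0 \<le> (H *v (w - sol g)) \<bullet> (w - sol g)"
    using w sol_in subspace_V by (intro nonneg) (simp add: subspace_diff)
  also have "\<dots> = (H *v w) \<bullet> w - 2 * ((H *v sol g) \<bullet> w) + (H *v sol g) \<bullet> sol g"
    using inner_symmetric_matrix[OF sym, of w "sol g"]
    by (simp add: matrix_vector_mult_diff_distrib inner_diff_left inner_diff_right inner_commute)
  finally show ?thesis using sol_eq[OF w, of g] by (simp add: energy)
qed

lemma norm_sol_le:
  assumes "0 < c" "\<And>v. c * (norm v)\<^sup>2 \<le> (H *v v) \<bullet> v"
  shows "norm (sol g) \<le> norm g / c"
proof (cases "sol g = 0")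
  case False
  have "c * (norm (sol g))\<^sup>2 \<le> g \<bullet> sol g" using assms(2)[of "sol g"] by (simp add: energy)
  also have "\<dots> \<le> norm g * norm (sol g)" by (rule norm_cauchy_schwarz)
  finally have "c * norm (sol g) \<le> norm g" using False by (simp add: power2_eq_square)
  with assms(1) show ?thesis by (simp add: field_simps)
qed (use assms in auto)

text \<open>
  The difference of two Galerkin solutions in the same space solves the Galerkin problem for the
  first form, with the defect of the data on the right-hand side. The constant depends only on the
  coercivity of the first form, hence is locally uniform in the Hessian.
\<close>

lemma sol_perturbation:
  assumes c: "0 < c" "\<And>v. c * (norm v)\<^sup>2 \<le> (H *v v) \<bullet> v"
    and u: "u \<in> V" "\<And>v. v \<in> V \<Longrightarrow> (H' *v u) \<bullet> v = g' \<bullet> v"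
  shows "norm (sol g - u) \<le> norm ((g - g') - (H - H') *v u) / c"
proof -
  have "sol g - u = sol (g - g' - (H - H') *v u)"
  proof (rule solI[symmetric])
    show "sol g - u \<in> V" using sol_in u subspace_V by (simp add: subspace_diff)
    show "(H *v (sol g - u)) \<bullet> v = (g - g' - (H - H') *v u) \<bullet> v" if "v \<in> V" for v
      using that u(2)[OF that] sol_eq[OF that, of g]
      by (simp add: matrix_vector_mult_diff_distrib matrix_vector_mult_diff_rdistrib inner_diff_left)
  qed
  with norm_sol_le[OF c, of "g - g' - (H - H') *v u"] show ?thesis by simp
qed

end

section \<open>The pseudoinverse of a sketched matrix\<close>

lemma transpose_eq_if_self_adjoint:
  fixes A :: "real^'n^'n"
  assumes "\<And>x y. (A *v x) \<bullet> y = x \<bullet> (A *v y)"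
  shows "transpose A = A"
proof -
  have "transpose A *v x = A *v x" for x
  proof -
    have "(transpose A *v x) \<bullet> y = (A *v x) \<bullet> y" for y
      using assms[of x y] by (simp add: dot_lmul_matrix)
    then show ?thesis using vector_eq_rdot by blast
  qed
  then show ?thesis by (metis matrix_eq)
qed

definition is_pinv :: "real mat \<Rightarrow> real mat \<Rightarrow> bool" where
  "is_pinv A X \<longleftrightarrow> X \<in> carrier_mat (dim_col A) (dim_row A) \<and>
     A * X * A = A \<and> X * A * X = X \<and>
     transpose_mat (A * X) = A * X \<and> transpose_mat (X * A) = X * A"

text \<open>
  Penrose's argument: \<open>A X\<close> and \<open>A Y\<close> are symmetric idempotents with the same range, hence
  equal, and likewise \<open>X A = Y A\<close>.
\<close>

lemma is_pinv_unique:
  assumes A: "A \<in> carrier_mat n n" and X: "is_pinv A X" and Y: "is_pinv A Y"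
  shows "X = Y"
proof -
  let ?M = "carrier_mat n n"
  have cX: "X \<in> ?M" and cY: "Y \<in> ?M"
    using A X Y by (auto simp: is_pinv_def)
  have X1: "A * X * A = A" "X * A * X = X"
    and X2: "transpose_mat (A * X) = A * X" "transpose_mat (X * A) = X * A"
    using X by (simp_all add: is_pinv_def)
  have Y1: "A * Y * A = A" "Y * A * Y = Y"
    and Y2: "transpose_mat (A * Y) = A * Y" "transpose_mat (Y * A) = Y * A"
    using Y by (simp_all add: is_pinv_def)
  have assoc: "P * Q * R = P * (Q * R)" if "P \<in> ?M" "Q \<in> ?M" "R \<in> ?M" for P Q R :: "real mat"
    using that by (rule assoc_mult_mat)
  have closed: "P * Q \<in> ?M" if "P \<in> ?M" "Q \<in> ?M" for P Q :: "real mat"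
    using that by (rule mult_carrier_mat)
  have commuted: "P * Q = Q * P"
    if "P \<in> ?M" "Q \<in> ?M" "transpose_mat P = P" "transpose_mat Q = Q" "transpose_mat (P * Q) = P * Q"
    for P Q :: "real mat"
    using transpose_mult[OF that(1,2)] that(3-5) by simp
  have AX: "A * X = A * Y"
  proof -
    have 1: "(A * Y) * (A * X) = A * X"
      using assoc[OF closed[OF A cY] A cX] Y1(1) by simp
    have 2: "(A * X) * (A * Y) = A * Y"
      using assoc[OF closed[OF A cX] A cY] X1(1) by simp
    show ?thesis
      using commuted[OF closed[OF A cY] closed[OF A cX] Y2(1) X2(1)] X2(1) 1 2 by simp
  qed
  have XA: "X * A = Y * A"
  proof -
    have 1: "(X * A) * (Y * A) = X * A"
      using assoc[OF cX A closed[OF cY A]] assoc[OF A cY A] Y1(1) by simp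
    have 2: "(Y * A) * (X * A) = Y * A"
      using assoc[OF cY A closed[OF cX A]] assoc[OF A cX A] X1(1) by simp
    show ?thesis
      using commuted[OF closed[OF cX A] closed[OF cY A] X2(2) Y2(2)] X2(2) 1 2 by simp
  qed
  have "X = X * (A * X)" using X1(2) assoc[OF cX A cX] by simp
  also have "\<dots> = (X * A) * Y" using AX assoc[OF cX A cY] by simp
  also have "\<dots> = Y" using XA Y1(2) by simp
  finally show ?thesis .
qed

lemma pinv_eqI:
  assumes "A \<in> carrier_mat n n" "is_pinv A X"
  shows "pinv A = X"
  unfolding pinv_def is_pinv_def[symmetric]
  by (rule the_equality) (use assms is_pinv_unique in blast)+

definition sk_range :: "('d::finite) sketch \<Rightarrow> (real^'d) set" where
  "sk_range T = span (sk_col T ` {..<sk_dim T})"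

lemma subspace_sk_range: "subspace (sk_range T)"
  unfolding sk_range_def by (rule subspace_span)

lemma sk_col_in_range: "j < sk_dim T \<Longrightarrow> sk_col T j \<in> sk_range T"
  unfolding sk_range_def by (auto intro: span_base)

lemma sk_mult_in_range: "sk_mult T h \<in> sk_range T"
  unfolding sk_mult_def
  by (intro subspace_sum[OF subspace_sk_range] subspace_scale[OF subspace_sk_range])
    (auto intro: sk_col_in_range)

lemma orthogonal_sk_range:
  assumes "\<And>j. j < sk_dim T \<Longrightarrow> sk_col T j \<bullet> x = 0" "v \<in> sk_range T"
  shows "x \<bullet> v = 0"
proof -
  have "orthogonal x v"
  proof (rule orthogonal_to_span)
    show "v \<in> span (sk_col T ` {..<sk_dim T})" using assms(2) by (simp add: sk_range_def)
    fix y assume "y \<in> sk_col T ` {..<sk_dim T}"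
    then obtain j where "j < sk_dim T" "y = sk_col T j" by blast
    then show "orthogonal x y"
      using assms(1)[of j] by (simp only: Linear_Algebra.orthogonal_def inner_commute[of x])
  qed
  then show ?thesis by (simp only: Linear_Algebra.orthogonal_def)
qed

lemma linear_sk_outer: "linear (\<lambda>v. sk_mult T (sk_transp T v))"
  unfolding sk_mult_def sk_transp_def
  by (rule linearI)
    (auto simp: inner_add_right scaleR_add_left sum.distrib scaleR_sum_right intro!: sum.cong)

lemma matrix_works_linear:
  fixes F :: "real^'n \<Rightarrow> real^'m"
  assumes "linear F" shows "matrix F *v v = F v"
  using assms by (simp add: matrix_works linear_matrix_vector_mul_eq)

lemma sk_outer_mult: "sk_outer T *v w = (\<Sum>j<sk_dim T. (sk_col T j \<bullet> w) *\<^sub>R sk_col T j)"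
proof -
  have "sk_outer T *v w = sk_mult T (sk_transp T w)"
    unfolding sk_outer_def by (rule matrix_works_linear[OF linear_sk_outer])
  then show ?thesis by (simp add: sk_mult_def sk_transp_def)
qed

lemma sk_outer_in_range: "sk_outer T *v w \<in> sk_range T"
  unfolding sk_outer_mult
  by (intro subspace_sum[OF subspace_sk_range] subspace_scale[OF subspace_sk_range])
    (auto intro: sk_col_in_range)

lemma sk_outer_form: "(sk_outer T *v x) \<bullet> y = (\<Sum>j<sk_dim T. (sk_col T j \<bullet> x) * (sk_col T j \<bullet> y))"
  by (simp add: sk_outer_mult inner_sum_left)

lemma sk_outer_symmetric: "transpose (sk_outer T) = sk_outer T"
proof (rule transpose_eq_if_self_adjoint)
  show "(sk_outer T *v x) \<bullet> y = x \<bullet> (sk_outer T *v y)" for x y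
    by (subst inner_commute[of x]) (simp only: sk_outer_form mult.commute)
qed

lemma galerkin_sk_outer: "galerkin (sk_outer T) (sk_range T)"
proof
  show "subspace (sk_range T)" by (rule subspace_sk_range)
  show "transpose (sk_outer T) = sk_outer T" by (rule sk_outer_symmetric)
  fix v assume v: "v \<in> sk_range T" "v \<noteq> 0"
  have "\<exists>j<sk_dim T. sk_col T j \<bullet> v \<noteq> 0"
  proof (rule ccontr)
    assume "\<not> (\<exists>j<sk_dim T. sk_col T j \<bullet> v \<noteq> 0)"
    then have "sk_col T j \<bullet> v = 0" if "j < sk_dim T" for j using that by blast
    from orthogonal_sk_range[OF this v(1)] v(2) show False by simp
  qed
  then obtain j where "j < sk_dim T" "sk_col T j \<bullet> v \<noteq> 0" by blast
  then show "0 < (sk_outer T *v v) \<bullet> v"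
    unfolding sk_outer_form power2_eq_square[symmetric] by (intro sum_pos2[of _ j]) auto
qed

lemma galerkin_pos_def:
  assumes "pos_def H" "subspace V" shows "galerkin H V"
  using assms by unfold_locales (auto simp: pos_def_def)

text \<open>
  The residual of the Galerkin solution lies in the range and is orthogonal to it.
\<close>

lemma sk_outer_sol:
  assumes "v \<in> sk_range T"
  shows "sk_outer T *v galerkin.sol (sk_outer T) (sk_range T) v = v"
proof -
  interpret galerkin "sk_outer T" "sk_range T" by (rule galerkin_sk_outer)
  have V: "sk_outer T *v sol v - v \<in> sk_range T"
    using assms sk_outer_in_range by (rule subspace_diff[OF subspace_sk_range, rotated])
  have "(sk_outer T *v sol v - v) \<bullet> (sk_outer T *v sol v - v) = 0"
    by (subst inner_diff_left) (simp only: sol_eq[OF V] diff_self)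
  then show ?thesis by simp
qed

text \<open>
  With \<open>F\<close> given by a matrix, this is \<open>S\<^sup>T F S\<close>. Products of such matrices are again of this kind,
  with \<open>S S\<^sup>T\<close> inserted between the factors, so that identities between matrices of the varying
  size of the sketch become identities between linear maps of the ambient space.
\<close>

definition gram :: "'d sketch \<Rightarrow> (real^'d \<Rightarrow> real^'d) \<Rightarrow> real mat" where
  "gram T F = Matrix.mat (sk_dim T) (sk_dim T) (\<lambda>(i, j). sk_col T i \<bullet> F (sk_col T j))"

lemma gram_carrier: "gram T F \<in> carrier_mat (sk_dim T) (sk_dim T)"
  by (simp add: gram_def)

lemma gram_mult:
  assumes F: "linear F"
  shows "gram T F * gram T G = gram T (\<lambda>v. F (sk_outer T *v G v))"
proof (rule eq_matI)
  fix i j assume "i < dim_row (gram T (\<lambda>v. F (sk_outer T *v G v)))"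
    "j < dim_col (gram T (\<lambda>v. F (sk_outer T *v G v)))"
  then have ij: "i < sk_dim T" "j < sk_dim T" by (auto simp: gram_def)
  have "(gram T F * gram T G) $$ (i, j) =
      (\<Sum>k<sk_dim T. (sk_col T i \<bullet> F (sk_col T k)) * (sk_col T k \<bullet> G (sk_col T j)))"
    using ij by (simp add: gram_def scalar_prod_def atLeast0LessThan)
  also have "\<dots> = sk_col T i \<bullet> F (sk_outer T *v G (sk_col T j))"
    by (simp add: sk_outer_mult linear_sum[OF F] linear_scale[OF F] inner_sum_right mult.commute)
  finally show "(gram T F * gram T G) $$ (i, j) = gram T (\<lambda>v. F (sk_outer T *v G v)) $$ (i, j)"
    using ij by (simp add: gram_def)
qed (auto simp: gram_def)

lemma gram_cong:
  assumes "\<And>i j. i < sk_dim T \<Longrightarrow> j < sk_dim T \<Longrightarrow>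
    sk_col T i \<bullet> F (sk_col T j) = sk_col T i \<bullet> G (sk_col T j)"
  shows "gram T F = gram T G"
  unfolding gram_def by (rule eq_matI) (auto simp: assms)

lemma gram_symmetric:
  assumes "\<And>x y. F x \<bullet> y = x \<bullet> F y"
  shows "transpose_mat (gram T F) = gram T F"
proof -
  have "sk_col T j \<bullet> F (sk_col T i) = sk_col T i \<bullet> F (sk_col T j)" for i j
    using assms[of "sk_col T i" "sk_col T j"] by (metis inner_commute)
  then show ?thesis unfolding gram_def by (intro eq_matI) auto
qed

lemma sk_hess_eq_gram: "sk_hess f T x = gram T ((*v) (hess f x))"
  by (simp add: sk_hess_def gram_def)

text \<open>
  The composite is the orthogonal projection onto the range of the sketch.
\<close>

lemma sk_outer_sol_outer:
  assumes v: "v \<in> sk_range T"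
  shows "v \<bullet> galerkin.sol (sk_outer T) (sk_range T) (sk_outer T *v z) = v \<bullet> z"
proof -
  interpret a: galerkin "sk_outer T" "sk_range T" by (rule galerkin_sk_outer)
  have "v \<bullet> a.sol (sk_outer T *v z) = (sk_outer T *v z) \<bullet> a.sol v"
    by (metis a.sol_symmetric inner_commute)
  also have "\<dots> = z \<bullet> (sk_outer T *v a.sol v)" by (rule inner_symmetric_matrix[OF a.sym])
  finally show ?thesis using sk_outer_sol[OF v] by (simp add: inner_commute)
qed

text \<open>
  In matrix terms \<open>(S S\<^sup>T)\<^sup>\<dagger> K (S S\<^sup>T)\<^sup>\<dagger>\<close>, where \<open>K\<close> is the inverse of \<open>H\<close> compressed to the range of
  the sketch.
\<close>

definition compressed_pinv :: "'d sketch \<Rightarrow> real^'d^'d \<Rightarrow> real^'d \<Rightarrow> real^'d" where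
  "compressed_pinv T H v =
     galerkin.sol (sk_outer T) (sk_range T)
       (galerkin.sol H (sk_range T) (galerkin.sol (sk_outer T) (sk_range T) v))"

lemma linear_compressed_pinv:
  assumes "pos_def H" shows "linear (compressed_pinv T H)"
proof -
  interpret h: galerkin H "sk_range T" by (rule galerkin_pos_def[OF assms subspace_sk_range])
  interpret a: galerkin "sk_outer T" "sk_range T" by (rule galerkin_sk_outer)
  show ?thesis
    using linear_compose[OF linear_compose[OF a.linear_sol h.linear_sol] a.linear_sol]
    by (simp add: compressed_pinv_def[abs_def] o_def)
qed

text \<open>
  Both products of \<open>S\<^sup>T H S\<close> with the candidate are \<open>S\<^sup>T (S S\<^sup>T)\<^sup>\<dagger> S\<close>, the orthogonal projection
  onto the row space of \<open>S\<close>. It is symmetric and fixes both matrices, which is all that Penrose's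
  conditions ask for. Since the pseudoinverse is a definite description, some such explicit candidate is
  needed before anything can be said about it.
\<close>

lemma pinv_gram:
  assumes H: "pos_def H"
  shows "pinv (gram T ((*v) H)) = gram T (compressed_pinv T H)"
proof (rule pinv_eqI[OF gram_carrier])
  let ?V = "sk_range T" and ?A = "sk_outer T"
  interpret h: galerkin H ?V by (rule galerkin_pos_def[OF H subspace_sk_range])
  interpret a: galerkin ?A ?V by (rule galerkin_sk_outer)
  let ?C = "gram T ((*v) H)" and ?P = "gram T a.sol"
  let ?N = "compressed_pinv T H"
  have N_in: "?N v \<in> ?V" for v by (simp add: compressed_pinv_def a.sol_in)
  \<comment> \<open>the solution for \<open>H\<close> lies in the range, where \<open>S S\<^sup>T\<close> undoes its inverse\<close>
  have AN: "?A *v ?N v = h.sol (a.sol v)" for v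
    unfolding compressed_pinv_def by (rule sk_outer_sol[OF h.sol_in])
  have CN: "?C * gram T ?N = ?P"
    unfolding gram_mult[OF matrix_vector_mul_linear] AN
  proof (rule gram_cong)
    fix i j assume "i < sk_dim T"
    then have s: "sk_col T i \<in> ?V" by (rule sk_col_in_range)
    have "sk_col T i \<bullet> (H *v h.sol (a.sol (sk_col T j))) = (H *v h.sol (a.sol (sk_col T j))) \<bullet> sk_col T i"
      by (rule inner_commute)
    also have "\<dots> = a.sol (sk_col T j) \<bullet> sk_col T i" by (rule h.sol_eq[OF s])
    finally show "sk_col T i \<bullet> (H *v h.sol (a.sol (sk_col T j))) = sk_col T i \<bullet> a.sol (sk_col T j)"
      by (simp add: inner_commute)
  qed
  have NC: "gram T ?N * ?C = ?P"
    unfolding gram_mult[OF linear_compressed_pinv[OF H]]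
  proof (rule gram_cong)
    fix i j assume "j < sk_dim T"
    then have s: "sk_col T j \<in> ?V" by (rule sk_col_in_range)
    have "h.sol (a.sol (?A *v (H *v sk_col T j))) = sk_col T j"
      by (rule h.solI[OF s]) (metis inner_commute sk_outer_sol_outer)
    then show "sk_col T i \<bullet> ?N (?A *v (H *v sk_col T j)) = sk_col T i \<bullet> a.sol (sk_col T j)"
      by (simp add: compressed_pinv_def)
  qed
  have PC: "?P * ?C = ?C"
    unfolding gram_mult[OF a.linear_sol]
    by (rule gram_cong) (simp add: sk_outer_sol_outer sk_col_in_range)
  have PN: "?P * gram T ?N = gram T ?N"
    unfolding gram_mult[OF a.linear_sol] a.sol_form[OF N_in] ..
  have "transpose_mat ?P = ?P" by (rule gram_symmetric) (rule a.sol_symmetric)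
  then show "is_pinv ?C (gram T ?N)"
    using gram_carrier by (simp add: is_pinv_def CN NC PC PN) (simp add: gram_def)
qed

lemma sk_mult_gram_transp:
  assumes "linear F"
  shows "sk_mult T (gram T F *\<^sub>v sk_transp T g) = sk_outer T *v F (sk_outer T *v g)"
proof -
  have "vec_index (gram T F *\<^sub>v sk_transp T g) i = sk_col T i \<bullet> F (sk_outer T *v g)"
    if "i < sk_dim T" for i
  proof -
    have "vec_index (gram T F *\<^sub>v sk_transp T g) i =
        (\<Sum>j<sk_dim T. (sk_col T i \<bullet> F (sk_col T j)) * (sk_col T j \<bullet> g))"
      using that by (simp add: gram_def sk_transp_def scalar_prod_def atLeast0LessThan)
    also have "\<dots> = sk_col T i \<bullet> F (sk_outer T *v g)"
      by (simp add: sk_outer_mult linear_sum[OF assms] linear_scale[OF assms] inner_sum_right mult.commute)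
    finally show ?thesis .
  qed
  then show ?thesis by (simp add: sk_mult_def sk_outer_mult)
qed

abbreviation sk_sol :: "(real^'d \<Rightarrow> real) \<Rightarrow> real^'d \<Rightarrow> 'd sketch \<Rightarrow> real^'d \<Rightarrow> real^'d" where
  "sk_sol f x T \<equiv> galerkin.sol (hess f x) (sk_range T)"

text \<open>
  The bridge between the pseudoinverse and Galerkin solutions: the sketched Newton direction
  \<open>S (S\<^sup>T H S)\<^sup>\<dagger> S\<^sup>T g\<close> depends on the sketch only through its range.
\<close>

lemma sk_mult_pinv_transp:
  assumes H: "pos_def (hess f x)"
  shows "sk_mult T (pinv (sk_hess f T x) *\<^sub>v sk_transp T g) = sk_sol f x T g"
proof -
  let ?V = "sk_range T" and ?A = "sk_outer T"
  interpret h: galerkin "hess f x" ?V by (rule galerkin_pos_def[OF H subspace_sk_range])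
  interpret a: galerkin ?A ?V by (rule galerkin_sk_outer)
  have "sk_mult T (pinv (sk_hess f T x) *\<^sub>v sk_transp T g) = h.sol (a.sol (?A *v g))"
    unfolding sk_hess_eq_gram pinv_gram[OF H] sk_mult_gram_transp[OF linear_compressed_pinv[OF H]]
    by (simp add: compressed_pinv_def sk_outer_sol[OF h.sol_in])
  also have "\<dots> = h.sol g"
    by (rule h.solI[OF h.sol_in]) (metis h.sol_eq inner_commute sk_outer_sol_outer)
  finally show ?thesis .
qed

section \<open>Sketched Newton steps\<close>

lemma sk_transp_carrier: "sk_transp T g \<in> carrier_vec (sk_dim T)"
  by (simp add: sk_transp_def)

lemma scalar_prod_sk_transp:
  assumes "y \<in> carrier_vec (sk_dim T)"
  shows "scalar_prod (sk_transp T g) y = g \<bullet> sk_mult T y"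
  using assms
  by (auto simp: scalar_prod_def sk_transp_def sk_mult_def inner_sum_right atLeast0LessThan
      inner_commute mult.commute intro!: sum.cong)

lemma pinv_sk_hess_carrier:
  assumes "pos_def (hess f x)"
  shows "pinv (sk_hess f T x) *\<^sub>v sk_transp T g \<in> carrier_vec (sk_dim T)"
  unfolding sk_hess_eq_gram pinv_gram[OF assms]
  by (rule mult_mat_vec_carrier[OF gram_carrier sk_transp_carrier])

lemma sk_dual_norm_transp:
  assumes "pos_def (hess f x)"
  shows "sk_dual_norm f T x (sk_transp T g) = sqrt (g \<bullet> sk_sol f x T g)"
  unfolding sk_dual_norm_def scalar_prod_sk_transp[OF pinv_sk_hess_carrier[OF assms]]
    sk_mult_pinv_transp[OF assms] ..

lemma sk_hess_mult:
  assumes "h \<in> carrier_vec (sk_dim T)"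
  shows "sk_hess f T x *\<^sub>v h = sk_transp T (hess f x *v sk_mult T h)"
proof (rule eq_vecI)
  fix i assume "i < dim_vec (sk_transp T (hess f x *v sk_mult T h))"
  then have i: "i < sk_dim T" by (simp add: sk_transp_def)
  have lin: "linear ((*v) (hess f x))" by (rule matrix_vector_mul_linear)
  show "vec_index (sk_hess f T x *\<^sub>v h) i = vec_index (sk_transp T (hess f x *v sk_mult T h)) i"
    using i assms
    by (simp add: sk_hess_def sk_transp_def sk_mult_def scalar_prod_def atLeast0LessThan
        linear_sum[OF lin] linear_scale[OF lin] inner_sum_right mult.commute)
qed (simp add: sk_hess_def sk_transp_def)

lemma sk_norm_square:
  assumes "pos_def (hess f x)" "h \<in> carrier_vec (sk_dim T)"
  shows "(sk_norm f T x h)\<^sup>2 = (hess f x *v sk_mult T h) \<bullet> sk_mult T h"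
proof -
  interpret galerkin "hess f x" "sk_range T"
    by (rule galerkin_pos_def[OF assms(1) subspace_sk_range])
  show ?thesis
    using nonneg[OF sk_mult_in_range]
    by (simp add: sk_norm_def sk_hess_mult[OF assms(2)] scalar_prod_sk_transp[OF assms(2)])
qed

lemma sk_mult_smult:
  assumes "h \<in> carrier_vec (sk_dim T)"
  shows "sk_mult T (c \<cdot>\<^sub>v h) = c *\<^sub>R sk_mult T h"
  using assms by (simp add: sk_mult_def scaleR_sum_right)

lemma sk_proj_mult:
  assumes "pos_def (hess f x)"
  shows "sk_proj f T x *v v = sk_sol f x T (hess f x *v v)"
proof -
  interpret galerkin "hess f x" "sk_range T"
    by (rule galerkin_pos_def[OF assms subspace_sk_range])
  have "linear (\<lambda>v. sol (hess f x *v v))"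
    using linear_compose[OF matrix_vector_mul_linear linear_sol] by (simp add: o_def)
  from matrix_works_linear[OF this] show ?thesis
    unfolding sk_proj_def sk_mult_pinv_transp[OF assms] .
qed

text \<open>
  The step size in a form without the singularity at \<open>G = 0\<close>, as the positive root of
  \<open>G \<alpha>\<^sup>2 / 2 + \<alpha> = 1\<close>. Continuity, the bounds and measurability are read off from it.
\<close>

definition stepsize :: "real \<Rightarrow> real" where
  "stepsize G = 2 / (1 + sqrt (1 + 2 * G))"

lemma stepsize_eq:
  assumes "0 < G" shows "(- 1 + sqrt (1 + 2 * G)) / G = stepsize G"
proof -
  let ?r = "sqrt (1 + 2 * G)"
  have "(- 1 + ?r) * (1 + ?r) = ?r\<^sup>2 - 1" by (simp add: algebra_simps power2_eq_square)
  also have "\<dots> = 2 * G" using assms by simp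
  finally have *: "(- 1 + ?r) * (1 + ?r) = 2 * G" .
  have r: "0 < 1 + ?r" using assms by (simp add: add_pos_nonneg)
  then have "(- 1 + ?r) / G = ((- 1 + ?r) * (1 + ?r)) / (G * (1 + ?r))" by simp
  also have "\<dots> = stepsize G" using assms unfolding * stepsize_def by simp
  finally show ?thesis .
qed

lemma stepsize_pos: "0 \<le> G \<Longrightarrow> 0 < stepsize G"
  unfolding stepsize_def by (intro divide_pos_pos add_pos_nonneg) auto

lemma stepsize_le_1: "0 \<le> G \<Longrightarrow> stepsize G \<le> 1"
  unfolding stepsize_def by (simp add: add_nonneg_pos)

lemma continuous_on_stepsize: "continuous_on {0..} stepsize"
proof -
  have "1 + sqrt (1 + 2 * G) \<noteq> 0" if "0 \<le> G" for G :: real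
    using real_sqrt_ge_zero[of "1 + 2 * G"] that by linarith
  then show ?thesis unfolding stepsize_def[abs_def] by (intro continuous_intros) auto
qed

text \<open>
  This is where the factor \<open>9 / 2\<close> in the choice of the parameter comes from: it makes
  \<open>1 + 2 G\<close> at least \<open>(3 l)\<^sup>2\<close>.
\<close>

lemma stepsize_bound:
  assumes "0 < l" "9 / 2 * l\<^sup>2 \<le> G" shows "stepsize G * l \<le> 2 / 3"
proof -
  have "3 * l = sqrt (9 * l\<^sup>2)" using assms(1) by (simp add: real_sqrt_mult)
  also have "\<dots> \<le> sqrt (1 + 2 * G)" using assms(2) by (intro real_sqrt_le_mono) simp
  finally have *: "3 * l \<le> 1 + sqrt (1 + 2 * G)" by simp
  then have "stepsize G \<le> 2 / (3 * l)"
    unfolding stepsize_def using assms(1) by (intro divide_left_mono mult_pos_pos) auto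
  then show ?thesis using assms(1) by (simp add: field_simps)
qed

lemma sgn_stepsize_eq:
  assumes "pos_def (hess f x)" "0 \<le> L"
  shows "sgn_stepsize L f x T = stepsize (L * sqrt (grad f x \<bullet> sk_sol f x T (grad f x)))"
proof -
  interpret galerkin "hess f x" "sk_range T"
    by (rule galerkin_pos_def[OF assms(1) subspace_sk_range])
  let ?G = "L * sqrt (grad f x \<bullet> sol (grad f x))"
  have G: "0 \<le> ?G" using assms(2) energy_nonneg by simp
  have eq: "sgn_stepsize L f x T = (if ?G = 0 then 1 else (- 1 + sqrt (1 + 2 * ?G)) / ?G)"
    unfolding sgn_stepsize_def sk_grad_def sk_dual_norm_transp[OF assms(1)] Let_def ..
  show ?thesis
  proof (cases "?G = 0")
    case True
    show ?thesis unfolding eq unfolding True stepsize_def by simp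
  next
    case False
    then show ?thesis unfolding eq using stepsize_eq[of ?G] G by (simp only: if_False)
  qed
qed

text \<open>
  Relative smoothness along the step bounds the new value by
  \<open>f x - \<alpha> (1 - \<alpha> l / 2) e\<close>, where \<open>e\<close> is the squared sketched dual norm of the gradient. For large
  gradients \<open>\<alpha> l \<le> 2 / 3\<close>, so the bracket is at least \<open>2 / 3\<close>.
\<close>

lemma sgn_step_decrease:
  assumes H: "pos_def (hess f x)" and smooth: "relatively_smooth_in f T l"
    and L: "0 < L" "9 / 2 * L * l\<^sup>2 \<le> Lalg"
    and big: "1 / L \<le> sk_dual_norm f T x (sk_grad f T x)"
  shows "f (sgn_step Lalg f x T) \<le>
    f x - 2 / 3 * (sgn_stepsize Lalg f x T * (grad f x \<bullet> sk_sol f x T (grad f x)))"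
proof -
  interpret galerkin "hess f x" "sk_range T"
    by (rule galerkin_pos_def[OF H subspace_sk_range])
  let ?g = "grad f x" let ?e = "?g \<bullet> sol ?g" and ?a = "sgn_stepsize Lalg f x T"
  have l: "0 < l" using smooth by (simp add: relatively_smooth_in_def)
  have e: "0 \<le> ?e" by (rule energy_nonneg)
  have Lalg: "0 \<le> Lalg" using L l by (smt (verit) mult_nonneg_nonneg zero_le_power2 divide_nonneg_nonneg)
  have sq: "1 / L \<le> sqrt ?e" using big by (simp add: sk_grad_def sk_dual_norm_transp[OF H])
  have "9 / 2 * l\<^sup>2 = (9 / 2 * L * l\<^sup>2) * (1 / L)" using L(1) by simp
  also have "\<dots> \<le> Lalg * sqrt ?e" using L sq Lalg by (intro mult_mono) auto
  finally have al: "?a * l \<le> 2 / 3"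
    unfolding sgn_stepsize_eq[OF H Lalg] by (rule stepsize_bound[OF l])
  have a: "0 < ?a" unfolding sgn_stepsize_eq[OF H Lalg] using Lalg e by (intro stepsize_pos) simp
  let ?w = "pinv (sk_hess f T x) *\<^sub>v sk_transp T ?g"
  let ?h = "(- ?a) \<cdot>\<^sub>v ?w"
  have w: "?w \<in> carrier_vec (sk_dim T)" by (rule pinv_sk_hess_carrier[OF H])
  then have h: "?h \<in> carrier_vec (sk_dim T)" by simp
  have Sh: "sk_mult T ?h = (- ?a) *\<^sub>R sol ?g"
    unfolding sk_mult_smult[OF w] sk_mult_pinv_transp[OF H] ..
  have "sgn_step Lalg f x T = x + sk_mult T ?h"
    unfolding sgn_step_def sk_grad_def Sh by (simp add: sk_mult_pinv_transp[OF H])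
  then have "f (sgn_step Lalg f x T) \<le>
      f x + scalar_prod (sk_grad f T x) ?h + l / 2 * (sk_norm f T x ?h)\<^sup>2"
    using smooth h by (simp only: relatively_smooth_in_def)
  also have "scalar_prod (sk_grad f T x) ?h = - ?a * ?e"
    unfolding sk_grad_def scalar_prod_sk_transp[OF h] Sh by simp
  also have "(sk_norm f T x ?h)\<^sup>2 = ?a\<^sup>2 * ?e"
    unfolding sk_norm_square[OF H h] Sh matrix_vector_mult_scaleR inner_scaleR_left
      inner_scaleR_right energy by (simp add: power2_eq_square)
  also have "f x + - ?a * ?e + l / 2 * (?a\<^sup>2 * ?e) = f x - (1 - ?a * l / 2) * (?a * ?e)"
    by (simp add: algebra_simps power2_eq_square)
  also have "\<dots> \<le> f x - 2 / 3 * (?a * ?e)"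
    using al a e by (intro diff_left_mono mult_right_mono) auto
  finally show ?thesis .
qed

section \<open>Continuity and measurability of Galerkin solutions\<close>

lemma continuous_on_matrix_vector_mult:
  fixes A :: "'a::topological_space \<Rightarrow> real^'n^'m"
  assumes "continuous_on S A" "continuous_on S w"
  shows "continuous_on S (\<lambda>p. A p *v w p)"
  unfolding matrix_vector_mult_def
  by (intro continuous_on_vec_lambda continuous_on_sum continuous_on_mult continuous_on_component assms)

lemma borel_measurable_matrix_vector_mult:
  fixes A :: "'a \<Rightarrow> real^'n^'m"
  assumes "A \<in> borel_measurable N" "w \<in> borel_measurable N"
  shows "(\<lambda>p. A p *v w p) \<in> borel_measurable N"
  using assms
  by (rule borel_measurable_continuous_Pair)
    (intro continuous_on_matrix_vector_mult continuous_intros)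

lemma borel_measurable_vec:
  fixes F :: "'a \<Rightarrow> 'b::euclidean_space^'n"
  assumes "\<And>i. (\<lambda>p. F p $ i) \<in> borel_measurable N"
  shows "F \<in> borel_measurable N"
proof (subst borel_measurable_euclidean_space, rule ballI)
  fix b :: "'b^'n" assume "b \<in> Basis"
  then obtain i u where b: "b = axis i u" by (auto simp: Basis_vec_def)
  show "(\<lambda>p. F p \<bullet> b) \<in> borel_measurable N"
    unfolding b inner_axis using assms by (intro borel_measurable_inner) auto
qed

lemma borel_measurable_matrix:
  fixes F :: "'a \<Rightarrow> real^'n^'m"
  assumes "\<And>v. (\<lambda>p. F p *v v) \<in> borel_measurable N"
  shows "F \<in> borel_measurable N"
proof (intro borel_measurable_vec)
  fix i j
  have "F p $ i $ j = (F p *v axis j 1) \<bullet> axis i 1" for p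
    by (simp add: matrix_vector_mul_component inner_axis)
  then show "(\<lambda>p. F p $ i $ j) \<in> borel_measurable N"
    using borel_measurable_inner[OF assms[of "axis j 1"], of "\<lambda>_. axis i 1"] by simp
qed

lemma compact_pos_def_coercive:
  fixes A :: "'a::t2_space \<Rightarrow> real^'n^'n"
  assumes Q: "compact Q" and A: "continuous_on Q A" and pd: "\<And>x. x \<in> Q \<Longrightarrow> pos_def (A x)"
  shows "\<exists>c>0. \<forall>x\<in>Q. \<forall>v. c * (norm v)\<^sup>2 \<le> (A x *v v) \<bullet> v"
proof (cases "Q = {}")
  case False
  let ?K = "Q \<times> sphere (0::real^'n) 1" and ?F = "\<lambda>p. (A (fst p) *v snd p) \<bullet> snd p"
  have "axis undefined 1 \<in> sphere (0::real^'n) 1" by (simp add: norm_axis_1)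
  then have ne: "?K \<noteq> {}" using False by blast
  have "compact ?K" by (intro compact_Times Q compact_sphere)
  moreover have "continuous_on ?K ?F"
    by (intro continuous_on_inner continuous_on_matrix_vector_mult continuous_on_compose2[OF A]
        continuous_on_fst continuous_on_snd continuous_on_id) auto
  ultimately obtain q where q: "q \<in> ?K" and min: "\<And>p. p \<in> ?K \<Longrightarrow> ?F q \<le> ?F p"
    using continuous_attains_inf[OF _ ne] by blast
  have "fst q \<in> Q" "snd q \<noteq> 0" using q by auto
  then have "0 < ?F q" using pd by (simp add: pos_def_def)
  moreover have "?F q * (norm v)\<^sup>2 \<le> (A x *v v) \<bullet> v" if "x \<in> Q" for x v
  proof (cases "v = 0")
    case False
    let ?u = "(1 / norm v) *\<^sub>R v"
    have "?F q \<le> ?F (x, ?u)" using that False by (intro min) auto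
    also have "\<dots> = ((A x *v v) \<bullet> v) / (norm v)\<^sup>2"
      unfolding fst_conv snd_conv matrix_vector_mult_scaleR inner_scaleR_left inner_scaleR_right
      by (simp add: power2_eq_square)
    finally show ?thesis using False by (simp add: field_simps)
  qed simp
  ultimately show ?thesis by blast
qed (auto intro: exI[of _ 1])

lemma continuous_on_sol:
  fixes A :: "'a::t2_space \<Rightarrow> real^'n^'n"
  assumes Q: "compact Q" and A: "continuous_on Q A" and pd: "\<And>x. x \<in> Q \<Longrightarrow> pos_def (A x)"
    and V: "subspace V"
  shows "continuous_on (Q \<times> UNIV) (\<lambda>p. galerkin.sol (A (fst p)) V (snd p))"
  unfolding continuous_on_def
proof
  let ?S = "\<lambda>p. galerkin.sol (A (fst p)) V (snd p)"
  obtain c where c: "0 < c" "\<And>x v. x \<in> Q \<Longrightarrow> c * (norm v)\<^sup>2 \<le> (A x *v v) \<bullet> v"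
    using compact_pos_def_coercive[OF Q A pd] by blast
  fix q :: "'a \<times> (real^'n)" assume q: "q \<in> Q \<times> UNIV"
  let ?B = "\<lambda>p. norm ((snd p - snd q) - (A (fst p) - A (fst q)) *v ?S q) / c"
  have le: "norm (?S p - ?S q) \<le> ?B p" if p: "p \<in> Q \<times> UNIV" for p
  proof -
    interpret q: galerkin "A (fst q)" V by (rule galerkin_pos_def) (use q pd V in auto)
    interpret p: galerkin "A (fst p)" V by (rule galerkin_pos_def) (use p pd V in auto)
    show ?thesis
      by (rule p.sol_perturbation) (use c p q.sol_in q.sol_eq in auto)
  qed
  have "continuous_on (Q \<times> UNIV) ?B"
    using c(1)
    by (intro continuous_intros continuous_on_matrix_vector_mult continuous_on_compose2[OF A]) auto
  then have "(?B \<longlongrightarrow> ?B q) (at q within Q \<times> UNIV)"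
    using q by (simp only: continuous_on_def)
  then have "(?B \<longlongrightarrow> 0) (at q within Q \<times> UNIV)" by simp
  then have "((\<lambda>p. ?S p - ?S q) \<longlongrightarrow> 0) (at q within Q \<times> UNIV)"
    by (rule Lim_null_comparison[rotated]) (auto simp: eventually_at_filter intro!: always_eventually le)
  then show "(?S \<longlongrightarrow> ?S q) (at q within Q \<times> UNIV)" by (rule LIM_zero_cancel)
qed

text \<open>
  In the variational description of the energy it suffices to let \<open>w\<close> range over \<open>S S\<^sup>T q\<close>
  with \<open>q\<close> from a countable dense set. This makes the energy a countable supremum of functions that are
  continuous in the Hessian, in \<open>g\<close> and in \<open>S S\<^sup>T\<close>, although the range of the sketch, and with it the
  solution, may jump.
\<close>

lemma borel_measurable_energy:
  fixes A :: "'a \<Rightarrow> real^'d^'d" and T :: "'a \<Rightarrow> 'd sketch"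
  assumes A: "A \<in> borel_measurable N" and g: "g \<in> borel_measurable N"
    and T: "(\<lambda>p. sk_outer (T p)) \<in> borel_measurable N" and pd: "\<And>p. pos_def (A p)"
  shows "(\<lambda>p. g p \<bullet> galerkin.sol (A p) (sk_range (T p)) (g p)) \<in> borel_measurable N"
proof -
  let ?e = "\<lambda>p. g p \<bullet> galerkin.sol (A p) (sk_range (T p)) (g p)"
  let ?q = "\<lambda>p w. 2 * (g p \<bullet> (sk_outer (T p) *v w)) -
    (A p *v (sk_outer (T p) *v w)) \<bullet> (sk_outer (T p) *v w)"
  obtain W :: "(real^'d) set" where W: "countable W" "\<And>X. open X \<Longrightarrow> X \<noteq> {} \<Longrightarrow> \<exists>w\<in>W. w \<in> X"
    using countable_dense_exists by blast
  have meas: "(\<lambda>p. ?q p w) \<in> borel_measurable N" for w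
    by (intro borel_measurable_diff borel_measurable_times borel_measurable_const borel_measurable_inner
        borel_measurable_matrix_vector_mult A g T)
  have iff: "c < ?e p \<longleftrightarrow> (\<exists>w\<in>W. c < ?q p w)" for c p
  proof -
    interpret galerkin "A p" "sk_range (T p)" by (rule galerkin_pos_def[OF pd subspace_sk_range])
    show ?thesis
    proof
      assume c: "c < ?e p"
      \<comment> \<open>\<open>S S\<^sup>T\<close> maps this point to the maximizer, and nearby points of the dense set do almost as well\<close>
      let ?w = "galerkin.sol (sk_outer (T p)) (sk_range (T p)) (sol (g p))"
      have "?q p ?w = ?e p"
        unfolding sk_outer_sol[OF sol_in] energy by simp
      then have "?w \<in> {w. c < ?q p w}" using c by (simp only: mem_Collect_eq)
      moreover have "open {w. c < ?q p w}"
        by (intro open_Collect_less continuous_intros continuous_on_matrix_vector_mult)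
      ultimately obtain w where "w \<in> W" "w \<in> {w. c < ?q p w}" using W(2) by blast
      then show "\<exists>w\<in>W. c < ?q p w" by blast
    next
      assume "\<exists>w\<in>W. c < ?q p w"
      then obtain w where "c < ?q p w" by blast
      also have "?q p w \<le> ?e p" by (rule energy_dual[OF sk_outer_in_range])
      finally show "c < ?e p" .
    qed
  qed
  show ?thesis
  proof (rule borel_measurable_iff_greater[THEN iffD2], intro allI)
    fix c
    have "{p \<in> space N. c < ?e p} = (\<Union>w\<in>W. {p \<in> space N. c < ?q p w})"
      unfolding iff by blast
    also have "\<dots> \<in> sets N"
      using meas W(1) by (intro sets.countable_UN'') (auto simp: borel_measurable_iff_greater)
    finally show "{p \<in> space N. c < ?e p} \<in> sets N" .
  qed
qed

text \<open>
  By polarization from the energy.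
\<close>

lemma borel_measurable_sol:
  fixes A :: "'a \<Rightarrow> real^'d^'d" and T :: "'a \<Rightarrow> 'd sketch"
  assumes A: "A \<in> borel_measurable N" and g: "g \<in> borel_measurable N"
    and T: "(\<lambda>p. sk_outer (T p)) \<in> borel_measurable N" and pd: "\<And>p. pos_def (A p)"
  shows "(\<lambda>p. galerkin.sol (A p) (sk_range (T p)) (g p)) \<in> borel_measurable N"
proof (subst borel_measurable_euclidean_space, rule ballI)
  fix b :: "real^'d"
  let ?e = "\<lambda>p g. g \<bullet> galerkin.sol (A p) (sk_range (T p)) g"
  have "galerkin.sol (A p) (sk_range (T p)) (g p) \<bullet> b = (?e p (g p + b) - ?e p (g p - b)) / 4" for p
  proof -
    interpret galerkin "A p" "sk_range (T p)" by (rule galerkin_pos_def[OF pd subspace_sk_range])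
    have "b \<bullet> sol (g p) = g p \<bullet> sol b" using sol_symmetric[of b "g p"] by (metis inner_commute)
    then show ?thesis
      by (simp add: linear_add[OF linear_sol] linear_diff[OF linear_sol] inner_add_left inner_add_right
          inner_diff_left inner_diff_right inner_commute[of "sol (g p)" b])
  qed
  moreover have "(\<lambda>p. (?e p (g p + b) - ?e p (g p - b)) / 4) \<in> borel_measurable N"
    by (intro borel_measurable_divide borel_measurable_diff borel_measurable_const
        borel_measurable_energy A T pd borel_measurable_add g)
  ultimately show "(\<lambda>p. galerkin.sol (A p) (sk_range (T p)) (g p) \<bullet> b) \<in> borel_measurable N"
    by (simp only:)
qed

section \<open>Dual norms and the support of a distribution\<close>

lemma pos_def_invertible:
  fixes H :: "real^'n^'n"
  assumes "pos_def H" shows "invertible H"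
proof -
  have "x = 0" if "H *v x = 0" for x
    using assms that unfolding pos_def_def by (metis inner_zero_left less_irrefl)
  then show ?thesis
    unfolding invertible_left_inverse matrix_left_invertible_ker by blast
qed

lemma matrix_inv_mult:
  fixes H :: "real^'n^'n"
  assumes "invertible H"
  shows "H ** matrix_inv H = Finite_Cartesian_Product.mat 1" "matrix_inv H ** H = Finite_Cartesian_Product.mat 1"
proof -
  from assms obtain X where "H ** X = Finite_Cartesian_Product.mat 1 \<and> X ** H = Finite_Cartesian_Product.mat 1" unfolding invertible_def by blast
  then have "H ** matrix_inv H = Finite_Cartesian_Product.mat 1 \<and> matrix_inv H ** H = Finite_Cartesian_Product.mat 1"
    unfolding matrix_inv_def by (rule someI)
  then show "H ** matrix_inv H = Finite_Cartesian_Product.mat 1" "matrix_inv H ** H = Finite_Cartesian_Product.mat 1" by auto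
qed

lemma matrix_inv_eq_sol:
  fixes H :: "real^'n^'n"
  assumes "pos_def H" shows "matrix_inv H *v g = galerkin.sol H UNIV g"
proof -
  interpret galerkin H UNIV by (rule galerkin_pos_def[OF assms subspace_UNIV])
  have "H *v sol g = g"
    using sol_eq[OF UNIV_I] vector_eq_rdot by blast
  then have "matrix_inv H *v g = (matrix_inv H ** H) *v sol g"
    by (simp only: matrix_vector_mul_assoc[symmetric])
  then show ?thesis
    by (simp add: matrix_inv_mult[OF pos_def_invertible[OF assms]])
qed

lemma pinv_type_eq_matrix_inv:
  fixes H :: "real^'n^'n"
  assumes "invertible H" shows "pinv_type H = matrix_inv H"
  unfolding pinv_type_def
proof (rule the_equality)
  note inv = matrix_inv_mult[OF assms]
  show "H ** matrix_inv H ** H = H \<and> matrix_inv H ** H ** matrix_inv H = matrix_inv H \<and>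
    transpose (H ** matrix_inv H) = H ** matrix_inv H \<and>
    transpose (matrix_inv H ** H) = matrix_inv H ** H"
    by (simp add: inv)
  fix X assume "H ** X ** H = H \<and> X ** H ** X = X \<and>
    transpose (H ** X) = H ** X \<and> transpose (X ** H) = X ** H"
  then have "matrix_inv H ** (H ** X ** H) ** matrix_inv H = matrix_inv H ** H ** matrix_inv H"
    by simp
  moreover have "matrix_inv H ** (H ** X ** H) ** matrix_inv H =
      (matrix_inv H ** H) ** X ** (H ** matrix_inv H)"
    by (simp only: matrix_mul_assoc)
  ultimately show "X = matrix_inv H" by (simp add: inv)
qed

lemma local_dual_norm_square:
  assumes "pos_def (hess f x)"
  shows "(local_dual_norm f x g)\<^sup>2 = g \<bullet> galerkin.sol (hess f x) UNIV g"
proof -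
  interpret galerkin "hess f x" UNIV by (rule galerkin_pos_def[OF assms subspace_UNIV])
  show ?thesis
    unfolding local_dual_norm_def matrix_inv_eq_sol[OF assms] using energy_nonneg by simp
qed

lemma energy_mono:
  assumes U: "galerkin H U" and V: "galerkin H V" and "U \<subseteq> V"
  shows "g \<bullet> galerkin.sol H U g \<le> g \<bullet> galerkin.sol H V g"
proof -
  interpret U: galerkin H U by (rule U)
  interpret V: galerkin H V by (rule V)
  have "2 * (g \<bullet> U.sol g) - (H *v U.sol g) \<bullet> U.sol g \<le> g \<bullet> V.sol g"
    using assms(3) U.sol_in by (intro V.energy_dual) blast
  then show ?thesis by (simp add: U.energy)
qed

text \<open>
  The complement of the support is the union of the null sets of a countable base.
\<close>

lemma AE_sk_support:
  fixes D :: "('d::finite) sketch measure"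
  assumes "sets D = sets borel"
  shows "AE T in D. T \<in> sk_support D"
proof -
  obtain B :: "'d sketch set set" where B: "countable B" "topological_basis B"
    using ex_countable_basis by blast
  let ?N = "\<Union>{U \<in> B. emeasure D U = 0}"
  have "?N \<in> null_sets D"
  proof (rule null_sets_UN'[of "{U \<in> B. emeasure D U = 0}" "\<lambda>U. U", simplified])
    show "countable {U \<in> B. emeasure D U = 0}" using B(1) by simp
    show "U \<in> null_sets D" if "U \<in> B \<and> emeasure D U = 0" for U
      using that topological_basis_open[OF B(2)] assms by (auto simp: null_sets_def)
  qed
  moreover have "{T \<in> space D. T \<notin> sk_support D} \<subseteq> ?N"
  proof
    fix T assume "T \<in> {T \<in> space D. T \<notin> sk_support D}"
    then obtain U where U: "open U" "T \<in> U" "emeasure D U = 0" by (auto simp: sk_support_def)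
    obtain W where W: "W \<in> B" "T \<in> W" "W \<subseteq> U"
      using topological_basisE[OF B(2) U(1,2)] by blast
    have "emeasure D W \<le> emeasure D U"
      using W(3) U(1) assms by (intro emeasure_mono) auto
    with U(3) W show "T \<in> ?N" by auto
  qed
  ultimately show ?thesis by (rule AE_I')
qed

section \<open>The conditioning constant\<close>

lemma norm_matrix_le_sum:
  fixes P :: "real^'n^'m"
  shows "norm P \<le> (\<Sum>i\<in>UNIV. \<Sum>j\<in>UNIV. \<bar>P $ i $ j\<bar>)"
proof -
  have "norm P \<le> (\<Sum>i\<in>UNIV. norm (P $ i))"
    unfolding norm_vec_def[of P] by (rule L2_set_le_sum) simp
  also have "\<dots> \<le> (\<Sum>i\<in>UNIV. \<Sum>j\<in>UNIV. \<bar>P $ i $ j\<bar>)"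
    by (intro sum_mono norm_le_l1_cart)
  finally show ?thesis .
qed

locale sketched_newton =
  fixes f :: "real^'d \<Rightarrow> real" and D :: "'d sketch measure" and Lalg :: real
  assumes pd: "\<And>x. pos_def (hess f x)"
    and hess_cont: "continuous_on UNIV (hess f)"
    and grad_cont: "continuous_on UNIV (grad f)"
    and D_prob: "prob_space D"
    and D_sets: "sets D = sets borel"
    and outer_meas: "(sk_outer :: 'd sketch \<Rightarrow> _) \<in> borel_measurable borel"
    and Lalg_nonneg: "0 \<le> Lalg"
begin

sublocale D: prob_space D by (rule D_prob)

lemma galerkin_hess: "subspace V \<Longrightarrow> galerkin (hess f x) V"
  by (rule galerkin_pos_def[OF pd])

lemmas galerkin_sk = galerkin_hess[OF subspace_sk_range]

lemmas galerkin_full = galerkin_hess[OF subspace_UNIV]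

abbreviation energy :: "real^'d \<Rightarrow> real^'d \<Rightarrow> 'd sketch \<Rightarrow> real" where
  "energy x g T \<equiv> g \<bullet> sk_sol f x T g"

abbreviation full_energy :: "real^'d \<Rightarrow> real^'d \<Rightarrow> real" where
  "full_energy x g \<equiv> g \<bullet> galerkin.sol (hess f x) UNIV g"

abbreviation step :: "real^'d \<Rightarrow> 'd sketch \<Rightarrow> real" where
  "step x T \<equiv> sgn_stepsize Lalg f x T"

lemma energy_nonneg: "0 \<le> energy x g T"
  by (rule galerkin.energy_nonneg[OF galerkin_sk])

lemma energy_le_full: "energy x g T \<le> full_energy x g"
  by (rule energy_mono[OF galerkin_sk galerkin_full]) simp

lemma full_energy_pos: "g \<noteq> 0 \<Longrightarrow> 0 < full_energy x g"
  using galerkin.energy_nonneg[OF galerkin_full, of g x]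
    galerkin.energy_zeroD[OF galerkin_full, of g x g] by force

lemma step_eq: "step x T = stepsize (Lalg * sqrt (energy x (grad f x) T))"
  by (rule sgn_stepsize_eq[OF pd Lalg_nonneg])

lemma step_pos: "0 < step x T"
  unfolding step_eq using Lalg_nonneg energy_nonneg by (intro stepsize_pos) simp

lemma step_le_1: "step x T \<le> 1"
  unfolding step_eq using Lalg_nonneg energy_nonneg by (intro stepsize_le_1) simp

lemma measurable_energy:
  assumes "X \<in> borel_measurable N" "g \<in> borel_measurable N" "T \<in> measurable N borel"
  shows "(\<lambda>p. energy (X p) (g p) (T p)) \<in> borel_measurable N"
  using measurable_compose[OF assms(1) borel_measurable_continuous_onI[OF hess_cont]] assms(2)
    measurable_compose[OF assms(3) outer_meas] pd
  by (rule borel_measurable_energy)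

lemma measurable_sk_sol:
  assumes "X \<in> borel_measurable N" "g \<in> borel_measurable N" "T \<in> measurable N borel"
  shows "(\<lambda>p. sk_sol f (X p) (T p) (g p)) \<in> borel_measurable N"
  using measurable_compose[OF assms(1) borel_measurable_continuous_onI[OF hess_cont]] assms(2)
    measurable_compose[OF assms(3) outer_meas] pd
  by (rule borel_measurable_sol)

lemma measurable_grad: "X \<in> borel_measurable N \<Longrightarrow> (\<lambda>p. grad f (X p)) \<in> borel_measurable N"
  by (rule measurable_compose[OF _ borel_measurable_continuous_onI[OF grad_cont]])

lemma measurable_step:
  assumes "X \<in> borel_measurable N" "T \<in> measurable N borel"
  shows "(\<lambda>p. step (X p) (T p)) \<in> borel_measurable N"
proof -
  have [measurable]: "(\<lambda>p. energy (X p) (grad f (X p)) (T p)) \<in> borel_measurable N"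
    by (intro measurable_energy measurable_grad assms)
  show ?thesis unfolding step_eq stepsize_def by measurable
qed

lemma measurable_sgn_step:
  assumes "X \<in> borel_measurable N" "T \<in> measurable N borel"
  shows "(\<lambda>p. sgn_step Lalg f (X p) (T p)) \<in> borel_measurable N"
  unfolding sgn_step_def sk_grad_def sk_mult_pinv_transp[OF pd]
  by (intro borel_measurable_diff borel_measurable_scaleR measurable_sk_sol measurable_step
      measurable_grad assms)

lemma measurable_id_D: "(\<lambda>T. T) \<in> measurable D borel"
  using D_sets by (simp add: measurable_ident_sets)

text \<open>
  Coercivity is uniform over the compact set and over all sketches. The second conjunct gives
  integrable bounds for the projections.
\<close>

lemma energy_bounded:
  assumes "compact Q"
  shows "\<exists>c>0. \<forall>x\<in>Q. \<forall>g T. energy x g T \<le> (norm g)\<^sup>2 / c \<and> norm (sk_sol f x T g) \<le> norm g / c"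
proof -
  obtain c where c: "0 < c" "\<And>x v. x \<in> Q \<Longrightarrow> c * (norm v)\<^sup>2 \<le> (hess f x *v v) \<bullet> v"
    using compact_pos_def_coercive[OF assms continuous_on_subset[OF hess_cont] pd] by blast
  have le: "norm (sk_sol f x T g) \<le> norm g / c" if "x \<in> Q" for x T g
    using galerkin.norm_sol_le[OF galerkin_sk c(1) c(2)[OF that]] .
  have "energy x g T \<le> (norm g)\<^sup>2 / c" if "x \<in> Q" for x g T
  proof -
    have "energy x g T \<le> norm g * norm (sk_sol f x T g)" by (rule norm_cauchy_schwarz)
    also have "\<dots> \<le> norm g * (norm g / c)" using le[OF that] by (rule mult_left_mono) simp
    finally show ?thesis by (simp add: power2_eq_square)
  qed
  with le c(1) show ?thesis by blast
qed

text \<open>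
  The numerator of the conditioning quotient at \<open>x\<close>, written with energies.
\<close>

definition mean_energy :: "real^'d \<Rightarrow> real^'d \<Rightarrow> real" where
  "mean_energy x g = (\<integral>T. step x T * energy x g T \<partial>D)"

lemma step_energy_nonneg: "0 \<le> step x T * energy x g T"
  using step_pos[of x T] energy_nonneg[of g x T] by simp

lemma step_energy_le: "step x T * energy x g T \<le> energy x g T"
  using mult_right_mono[OF step_le_1 energy_nonneg] by simp

lemma measurable_step_energy:
  "(\<lambda>T. step x T * energy x g T) \<in> borel_measurable D"
  by (intro borel_measurable_times measurable_step measurable_energy measurable_id_D) auto

lemma integrable_step_energy: "integrable D (\<lambda>T. step x T * energy x g T)"
proof (rule D.integrable_const_bound[OF _ measurable_step_energy])
  show "AE T in D. norm (step x T * energy x g T) \<le> full_energy x g"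
    using step_energy_nonneg step_energy_le energy_le_full
    by (intro AE_I2) (simp add: order_trans[OF step_energy_le energy_le_full])
qed

lemma mean_energy_le_full: "mean_energy x g \<le> full_energy x g"
proof -
  have "mean_energy x g \<le> (\<integral>T. full_energy x g \<partial>D)"
    unfolding mean_energy_def
    by (intro integral_mono integrable_step_energy order_trans[OF step_energy_le energy_le_full]) simp
  then show ?thesis by (simp add: D.prob_space)
qed

lemma mean_energy_nonneg: "0 \<le> mean_energy x g"
  unfolding mean_energy_def by (intro integral_nonneg_AE AE_I2 step_energy_nonneg)

lemma sk_sol_scale: "sk_sol f x T (t *\<^sub>R g) = t *\<^sub>R sk_sol f x T g"
  by (rule linear_scale[OF galerkin.linear_sol[OF galerkin_sk]])

lemma mean_energy_scale: "mean_energy x (t *\<^sub>R g) = t\<^sup>2 * mean_energy x g"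
proof -
  have "mean_energy x (t *\<^sub>R g) = (\<integral>T. t\<^sup>2 * (step x T * energy x g T) \<partial>D)"
    unfolding mean_energy_def sk_sol_scale by (simp add: power2_eq_square mult_ac)
  then show ?thesis by (simp add: mean_energy_def)
qed

lemma full_energy_scale: "full_energy x (t *\<^sub>R g) = t\<^sup>2 * full_energy x g"
  by (simp add: linear_scale[OF galerkin.linear_sol[OF galerkin_full]] power2_eq_square)

text \<open>
  If the mean vanishes, then \<open>g\<close> is orthogonal to the range of almost every sketch and so to the
  range of the mean of \<open>S S\<^sup>T\<close>, which contains the range of the invertible Hessian and hence \<open>g\<close> itself.
\<close>

lemma mean_energy_pos:
  assumes outer_int: "integrable D sk_outer"
    and range_cond: "\<And>x. range (\<lambda>v. hess f x *v v) \<subseteq> range (\<lambda>v. integral\<^sup>L D sk_outer *v v)"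
    and g: "g \<noteq> 0"
  shows "0 < mean_energy x g"
proof (rule ccontr)
  assume "\<not> 0 < mean_energy x g"
  then have "mean_energy x g = 0" using mean_energy_nonneg[of x g] by simp
  then have "AE T in D. step x T * energy x g T = 0"
    unfolding mean_energy_def
    by (subst (asm) integral_nonneg_eq_0_iff_AE[OF integrable_step_energy])
      (auto intro: AE_I2 step_energy_nonneg)
  then have AE: "AE T in D. energy x g T = 0"
    by eventually_elim (metis less_irrefl mult_eq_0_iff step_pos)
  have orth: "g \<bullet> (integral\<^sup>L D sk_outer *v w) = 0" for w
  proof -
    have lin: "bounded_linear (\<lambda>A. g \<bullet> (A *v w))"
      by (intro linear_conv_bounded_linear[THEN iffD1] linearI)
        (simp_all add: matrix_vector_mult_add_rdistrib inner_add_right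
          scaleR_matrix_vector_assoc[symmetric])
    have "g \<bullet> (integral\<^sup>L D sk_outer *v w) = (\<integral>T. g \<bullet> (sk_outer T *v w) \<partial>D)"
      by (rule integral_bounded_linear[OF lin outer_int, symmetric])
    also have "\<dots> = (\<integral>T. 0 \<partial>D)"
    proof (rule integral_cong_AE)
      show "(\<lambda>T. g \<bullet> (sk_outer T *v w)) \<in> borel_measurable D"
        using integrable_bounded_linear[OF lin outer_int] by (rule borel_measurable_integrable)
      show "AE T in D. g \<bullet> (sk_outer T *v w) = 0"
        using AE by eventually_elim (rule galerkin.energy_zeroD[OF galerkin_sk _ sk_outer_in_range])
    qed simp
    finally show ?thesis by simp
  qed
  have "g = hess f x *v (matrix_inv (hess f x) *v g)"
    by (simp add: matrix_vector_mul_assoc matrix_inv_mult[OF pos_def_invertible[OF pd]])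
  then have "g \<in> range (\<lambda>v. integral\<^sup>L D sk_outer *v v)" using range_cond by blast
  then have "g \<bullet> g = 0" using orth by force
  with g show False by simp
qed

lemma integrable_step_proj: "integrable D (\<lambda>T. step x T *\<^sub>R sk_proj f T x)"
proof -
  obtain c where c: "0 < c" "\<And>g T. norm (sk_sol f x T g) \<le> norm g / c"
    using energy_bounded[of "{x}"] by auto
  let ?B = "\<Sum>i\<in>(UNIV :: 'd set). \<Sum>j\<in>UNIV. norm (hess f x *v axis j 1) / c"
  show ?thesis
  proof (rule D.integrable_const_bound)
    show "(\<lambda>T. step x T *\<^sub>R sk_proj f T x) \<in> borel_measurable D"
    proof (rule borel_measurable_matrix)
      show "(\<lambda>T. (step x T *\<^sub>R sk_proj f T x) *v v) \<in> borel_measurable D" for v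
        unfolding scaleR_matrix_vector_assoc[symmetric] sk_proj_mult[OF pd]
        by (intro borel_measurable_scaleR measurable_step measurable_sk_sol measurable_id_D) auto
    qed
    have entry: "\<bar>sk_proj f T x $ i $ j\<bar> \<le> norm (hess f x *v axis j 1) / c" for T i j
    proof -
      have "\<bar>sk_proj f T x $ i $ j\<bar> = \<bar>(sk_proj f T x *v axis j 1) $ i\<bar>"
        by (simp add: matrix_vector_mul_component inner_axis)
      also have "\<dots> \<le> norm (sk_proj f T x *v axis j 1)" by (rule component_le_norm_cart)
      also have "\<dots> \<le> norm (hess f x *v axis j 1) / c"
        unfolding sk_proj_mult[OF pd] by (rule c(2))
      finally show ?thesis .
    qed
    have "norm (step x T *\<^sub>R sk_proj f T x) \<le> ?B" for T
    proof -
      have "norm (step x T *\<^sub>R sk_proj f T x) \<le> 1 * norm (sk_proj f T x)"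
        unfolding norm_scaleR using step_le_1 step_pos[of x T] by (intro mult_right_mono) auto
      also have "1 * norm (sk_proj f T x) \<le> (\<Sum>i\<in>UNIV. \<Sum>j\<in>UNIV. \<bar>sk_proj f T x $ i $ j\<bar>)"
        using norm_matrix_le_sum by simp
      also have "\<dots> \<le> ?B" by (intro sum_mono entry)
      finally show ?thesis .
    qed
    then show "AE T in D. norm (step x T *\<^sub>R sk_proj f T x) \<le> ?B" by simp
  qed
qed

text \<open>
  The Hessian in \<open>P\<^sub>x\<close> cancels against its inverse.
\<close>

lemma mean_energy_eq_form:
  "g \<bullet> ((integral\<^sup>L D (\<lambda>T. step x T *\<^sub>R sk_proj f T x) ** pinv_type (hess f x)) *v g) =
    mean_energy x g"
proof -
  let ?v = "matrix_inv (hess f x) *v g"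
  have v: "hess f x *v ?v = g"
    by (simp add: matrix_vector_mul_assoc matrix_inv_mult[OF pos_def_invertible[OF pd]])
  have lin: "bounded_linear (\<lambda>P::real^'d^'d. g \<bullet> (P *v ?v))"
    by (intro linear_conv_bounded_linear[THEN iffD1] linearI)
      (simp_all add: matrix_vector_mult_add_rdistrib inner_add_right
        scaleR_matrix_vector_assoc[symmetric])
  have "g \<bullet> ((integral\<^sup>L D (\<lambda>T. step x T *\<^sub>R sk_proj f T x) ** pinv_type (hess f x)) *v g) =
      g \<bullet> (integral\<^sup>L D (\<lambda>T. step x T *\<^sub>R sk_proj f T x) *v ?v)"
    by (simp only: pinv_type_eq_matrix_inv[OF pos_def_invertible[OF pd]] matrix_vector_mul_assoc)
  also have "\<dots> = (\<integral>T. g \<bullet> ((step x T *\<^sub>R sk_proj f T x) *v ?v) \<partial>D)"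
    by (rule integral_bounded_linear[OF lin integrable_step_proj, symmetric])
  also have "\<dots> = mean_energy x g"
    unfolding mean_energy_def scaleR_matrix_vector_assoc[symmetric] sk_proj_mult[OF pd] v by simp
  finally show ?thesis .
qed

lemma continuous_on_energy:
  assumes "compact Q"
  shows "continuous_on (Q \<times> UNIV) (\<lambda>p. energy (fst p) (snd p) T)"
  by (intro continuous_on_inner continuous_on_snd continuous_on_id
      continuous_on_sol[OF assms continuous_on_subset[OF hess_cont] pd subspace_sk_range]) auto

lemma continuous_on_step:
  assumes "compact Q"
  shows "continuous_on Q (\<lambda>x. step x T)"
proof -
  have "continuous_on Q (\<lambda>x. energy (fst (x, grad f x)) (snd (x, grad f x)) T)"
    by (rule continuous_on_compose2[OF continuous_on_energy[OF assms]])
      (auto intro!: continuous_intros continuous_on_subset[OF grad_cont])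
  then have e: "continuous_on Q (\<lambda>x. energy x (grad f x) T)" by simp
  have "0 \<le> Lalg * sqrt (energy x (grad f x) T)" for x
    using energy_nonneg Lalg_nonneg by simp
  then show ?thesis
    unfolding step_eq
    by (intro continuous_on_compose2[OF continuous_on_stepsize
          continuous_on_mult[OF continuous_on_const continuous_on_real_sqrt[OF e]]]) auto
qed

text \<open>
  By dominated convergence: for a fixed sketch the integrand is continuous, and its bound
  \<open>1 / c\<close> does not depend on the sketch.
\<close>

lemma continuous_on_mean_energy:
  assumes Q: "compact Q"
  shows "continuous_on (Q \<times> sphere 0 1) (\<lambda>p. mean_energy (fst p) (snd p))"
proof (rule continuous_on_sequentiallyI)
  fix u and p :: "(real^'d) \<times> (real^'d)"
  assume u: "\<forall>n. u n \<in> Q \<times> sphere 0 1" and p: "p \<in> Q \<times> sphere 0 1" and lim: "u \<longlonglongrightarrow> p"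
  obtain c where c: "0 < c" "\<And>x g T. x \<in> Q \<Longrightarrow> energy x g T \<le> (norm g)\<^sup>2 / c"
    using energy_bounded[OF Q] by blast
  have cont: "continuous_on (Q \<times> UNIV) (\<lambda>p. step (fst p) T * energy (fst p) (snd p) T)" for T
    by (intro continuous_on_mult continuous_on_energy[OF Q]
        continuous_on_compose2[OF continuous_on_step[OF Q]] continuous_on_fst continuous_on_id) auto
  have u': "u n \<in> Q \<times> UNIV" for n using u by (metis mem_Times_iff UNIV_I)
  have p': "p \<in> Q \<times> UNIV" using p by (metis mem_Times_iff UNIV_I)
  show "(\<lambda>n. mean_energy (fst (u n)) (snd (u n))) \<longlonglongrightarrow> mean_energy (fst p) (snd p)"
    unfolding mean_energy_def
  proof (rule integral_dominated_convergence[where w = "\<lambda>T. 1 / c"])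
    show "AE T in D. (\<lambda>n. step (fst (u n)) T * energy (fst (u n)) (snd (u n)) T)
        \<longlonglongrightarrow> step (fst p) T * energy (fst p) (snd p) T"
      by (intro AE_I2 continuous_on_tendsto_compose[OF cont lim p'] always_eventually allI u')
    show "AE T in D. norm (step (fst (u n)) T * energy (fst (u n)) (snd (u n)) T) \<le> 1 / c" for n
    proof (rule AE_I2)
      fix T
      have n: "fst (u n) \<in> Q" "norm (snd (u n)) = 1" using u[rule_format, of n] by auto
      have "energy (fst (u n)) (snd (u n)) T \<le> 1 / c" using c(2)[OF n(1), of "snd (u n)"] n(2) by simp
      then show "norm (step (fst (u n)) T * energy (fst (u n)) (snd (u n)) T) \<le> 1 / c"
        using step_energy_nonneg step_energy_le order_trans by simp blast
    qed
  qed (auto intro: measurable_step_energy)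
qed

lemma continuous_on_full_energy:
  assumes "compact Q"
  shows "continuous_on (Q \<times> UNIV) (\<lambda>p. full_energy (fst p) (snd p))"
  by (intro continuous_on_inner continuous_on_snd continuous_on_id
      continuous_on_sol[OF assms continuous_on_subset[OF hess_cont] pd subspace_UNIV]) auto

text \<open>
  The quotient is homogeneous of degree \<open>0\<close> in the direction, so the minimum is over a compact
  set. Minimizing over points and directions at once yields the two nested minima of the definition of
  \<open>\<rho>\<close>, with \<open>Q\<close> a single point or the level set.
\<close>

lemma energy_ratio_attains_min:
  assumes Q: "compact Q" "Q \<noteq> {}"
  shows "\<exists>x\<in>Q. \<exists>g. g \<noteq> 0 \<and> (\<forall>y\<in>Q. \<forall>h. h \<noteq> 0 \<longrightarrow>
    mean_energy x g / full_energy x g \<le> mean_energy y h / full_energy y h)"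
proof -
  let ?K = "Q \<times> sphere (0::real^'d) 1"
  let ?r = "\<lambda>p. mean_energy (fst p) (snd p) / full_energy (fst p) (snd p)"
  have "axis undefined 1 \<in> sphere (0::real^'d) 1" by (simp add: norm_axis_1)
  then have ne: "?K \<noteq> {}" using Q(2) by blast
  have "full_energy (fst p) (snd p) \<noteq> 0" if "p \<in> ?K" for p
  proof -
    have "snd p \<noteq> 0" using that by (auto simp: mem_Times_iff)
    then show ?thesis using full_energy_pos[of "snd p" "fst p"] by simp
  qed
  then have "continuous_on ?K ?r"
    by (intro continuous_on_divide continuous_on_mean_energy[OF Q(1)]
        continuous_on_subset[OF continuous_on_full_energy[OF Q(1)]]) auto
  then obtain p where p: "p \<in> ?K" and min: "\<And>q. q \<in> ?K \<Longrightarrow> ?r p \<le> ?r q"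
    using continuous_attains_inf[OF compact_Times[OF Q(1) compact_sphere] ne] by blast
  have "?r p \<le> mean_energy y h / full_energy y h" if y: "y \<in> Q" and h: "h \<noteq> 0" for y h
  proof -
    have "?r p \<le> ?r (y, (1 / norm h) *\<^sub>R h)" using y h by (intro min) auto
    also have "\<dots> = mean_energy y h / full_energy y h"
      unfolding fst_conv snd_conv mean_energy_scale full_energy_scale using h by simp
    finally show ?thesis .
  qed
  moreover have "fst p \<in> Q" "snd p \<noteq> 0" using p by auto
  ultimately show ?thesis by blast
qed

lemma rho_at_eq:
  "rho_at Lalg f D x = (LEAST r. \<exists>g. g \<noteq> 0 \<and> r = mean_energy x g / full_energy x g)"
  unfolding rho_at_def mean_energy_eq_form local_dual_norm_square[OF pd] ..

lemma rho_at_least: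
  shows "\<exists>g. g \<noteq> 0 \<and> rho_at Lalg f D x = mean_energy x g / full_energy x g"
    and "h \<noteq> 0 \<Longrightarrow> rho_at Lalg f D x \<le> mean_energy x h / full_energy x h"
proof -
  obtain g where g: "g \<noteq> 0"
    "\<And>h. h \<noteq> 0 \<Longrightarrow> mean_energy x g / full_energy x g \<le> mean_energy x h / full_energy x h"
    using energy_ratio_attains_min[of "{x}"] by auto
  have "rho_at Lalg f D x = mean_energy x g / full_energy x g"
    unfolding rho_at_eq by (rule Least_equality) (use g in auto)
  with g show "\<exists>g. g \<noteq> 0 \<and> rho_at Lalg f D x = mean_energy x g / full_energy x g"
    and "h \<noteq> 0 \<Longrightarrow> rho_at Lalg f D x \<le> mean_energy x h / full_energy x h" by auto
qed

lemma rho_min_least: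
  assumes "compact (level_set f x0)"
  shows "\<exists>x\<in>level_set f x0. rho_min Lalg f D x0 = rho_at Lalg f D x"
    and "y \<in> level_set f x0 \<Longrightarrow> rho_min Lalg f D x0 \<le> rho_at Lalg f D y"
proof -
  have "x0 \<in> level_set f x0" by (simp add: level_set_def)
  then obtain x g where x: "x \<in> level_set f x0" "g \<noteq> 0"
    "\<And>y h. y \<in> level_set f x0 \<Longrightarrow> h \<noteq> 0 \<Longrightarrow>
      mean_energy x g / full_energy x g \<le> mean_energy y h / full_energy y h"
    using energy_ratio_attains_min[OF assms] by blast
  have le: "rho_at Lalg f D x \<le> rho_at Lalg f D y" if "y \<in> level_set f x0" for y
    using rho_at_least(1)[of y] rho_at_least(2)[OF x(2), of x] x(3)[OF that] by fastforce
  have "rho_min Lalg f D x0 = rho_at Lalg f D x"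
    unfolding rho_min_def by (rule Least_equality) (use x(1) le in auto)
  with x(1) le show "\<exists>x\<in>level_set f x0. rho_min Lalg f D x0 = rho_at Lalg f D x"
    and "y \<in> level_set f x0 \<Longrightarrow> rho_min Lalg f D x0 \<le> rho_at Lalg f D y" by auto
qed

lemma rho_min_pos:
  assumes "compact (level_set f x0)" "integrable D sk_outer"
    and "\<And>x. range (\<lambda>v. hess f x *v v) \<subseteq> range (\<lambda>v. integral\<^sup>L D sk_outer *v v)"
  shows "0 < rho_min Lalg f D x0"
  using rho_min_least(1)[OF assms(1)] rho_at_least(1) mean_energy_pos[OF assms(2,3)] full_energy_pos
  by (metis divide_pos_pos)

lemma rho_min_le_1:
  assumes "compact (level_set f x0)"
  shows "rho_min Lalg f D x0 \<le> 1"
proof -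
  obtain x g where "g \<noteq> 0" "rho_min Lalg f D x0 = mean_energy x g / full_energy x g"
    using rho_min_least(1)[OF assms] rho_at_least(1) by metis
  then show ?thesis
    using mean_energy_le_full[of x g] full_energy_pos[of g x] by simp
qed

lemma rho_min_mean_energy:
  assumes "compact (level_set f x0)" "x \<in> level_set f x0"
  shows "rho_min Lalg f D x0 * full_energy x g \<le> mean_energy x g"
proof (cases "g = 0")
  case False
  have "rho_min Lalg f D x0 \<le> mean_energy x g / full_energy x g"
    using rho_min_least(2)[OF assms] rho_at_least(2)[OF False, of x] by linarith
  then show ?thesis using full_energy_pos[OF False, of x] by (simp add: field_simps)
qed (simp add: mean_energy_def)

end

section \<open>Consequences of relative convexity\<close>

lemma grad_eq_0_at_minimum:
  assumes "f differentiable (at x)" "\<And>y. f x \<le> f y"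
  shows "grad f x = 0"
proof -
  obtain f' where f': "(f has_derivative f') (at x)"
    using assms(1) by (auto simp: differentiable_def)
  have "f' = (\<lambda>v. 0)"
    by (rule differential_zero_maxmin[OF UNIV_I open_UNIV f']) (simp add: assms(2))
  with f' have G: "GDERIV f x :> 0" by (simp add: gderiv_def)
  show ?thesis unfolding grad_def
  proof (rule the_equality[where P = "\<lambda>g. GDERIV f x :> g", OF G])
    fix g assume g: "GDERIV f x :> g"
    have "(\<lambda>h. h \<bullet> g) = (\<lambda>h. h \<bullet> 0)"
      by (rule has_derivative_unique[OF g[unfolded gderiv_def] G[unfolded gderiv_def]])
    from fun_cong[OF this, of g] show "g = 0" by simp
  qed
qed

lemma local_norm_square:
  assumes "pos_def (hess f x)" shows "(local_norm f x h)\<^sup>2 = (hess f x *v h) \<bullet> h"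
  using galerkin.nonneg[OF galerkin_pos_def[OF assms subspace_UNIV] UNIV_I]
  by (simp add: local_norm_def)

lemma relatively_convexD:
  assumes "pos_def (hess f x)" "relatively_convex f \<mu>"
  shows "0 < \<mu>"
    and "f x + grad f x \<bullet> (y - x) + \<mu> / 2 * ((hess f x *v (y - x)) \<bullet> (y - x)) \<le> f y"
  using assms(2) unfolding relatively_convex_def local_norm_square[OF assms(1), symmetric] by blast+

text \<open>
  Relative convexity bounds the gap by a concave quadratic in \<open>y - x\<close>, which in the variational
  description of the full dual norm is the value at \<open>w = - \<mu> (y - x)\<close>.
\<close>

lemma relatively_convex_gap:
  assumes H: "pos_def (hess f x)" and conv: "relatively_convex f \<mu>"
  shows "2 * \<mu> * (f x - f y) \<le> grad f x \<bullet> galerkin.sol (hess f x) UNIV (grad f x)"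
proof -
  interpret galerkin "hess f x" UNIV by (rule galerkin_pos_def[OF H subspace_UNIV])
  let ?h = "y - x" and ?g = "grad f x"
  have \<mu>: "0 < \<mu>" and le: "f x + ?g \<bullet> ?h + \<mu> / 2 * ((hess f x *v ?h) \<bullet> ?h) \<le> f y"
    using relatively_convexD[OF H conv] by blast+
  have "f x - f y \<le> - (?g \<bullet> ?h) - \<mu> / 2 * ((hess f x *v ?h) \<bullet> ?h)" using le by linarith
  from mult_left_mono[OF this, of "2 * \<mu>"]
  have "2 * \<mu> * (f x - f y) \<le> 2 * \<mu> * (- (?g \<bullet> ?h) - \<mu> / 2 * ((hess f x *v ?h) \<bullet> ?h))"
    using \<mu> by simp
  also have "\<dots> = 2 * (?g \<bullet> ((- \<mu>) *\<^sub>R ?h)) - (hess f x *v ((- \<mu>) *\<^sub>R ?h)) \<bullet> ((- \<mu>) *\<^sub>R ?h)"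
    unfolding matrix_vector_mult_scaleR inner_scaleR_left inner_scaleR_right
    by (simp add: algebra_simps)
  also have "\<dots> \<le> ?g \<bullet> sol ?g" by (rule energy_dual[OF UNIV_I])
  finally show ?thesis .
qed

text \<open>
  At a critical point relative convexity reads
  \<open>f y \<ge> f z + \<mu> / 2 \<parallel>y - z\<parallel>\<^sub>z\<^sup>2\<close>: the function grows quadratically.
\<close>

lemma compact_level_set:
  assumes cont: "continuous_on UNIV f" and H: "pos_def (hess f z)"
    and conv: "relatively_convex f \<mu>" and z: "grad f z = 0"
  shows "compact (level_set f x0)"
proof -
  obtain c where c: "0 < c" "\<And>v. c * (norm v)\<^sup>2 \<le> (hess f z *v v) \<bullet> v"
    using compact_pos_def_coercive[of "{z}" "hess f"] H by auto
  have \<mu>: "0 < \<mu>" using relatively_convexD[OF H conv] by blast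
  \<comment> \<open>the squared radius that quadratic growth allows on the level set\<close>
  let ?R = "2 * (f x0 - f z) / (\<mu> * c)"
  have "level_set f x0 \<subseteq> cball z (sqrt ?R)"
  proof
    fix y assume "y \<in> level_set f x0"
    then have y: "f y \<le> f x0" by (simp add: level_set_def)
    have "f z + \<mu> / 2 * ((hess f z *v (y - z)) \<bullet> (y - z)) \<le> f y"
      using relatively_convexD(2)[OF H conv, of y] z by simp
    moreover have "\<mu> / 2 * (c * (norm (y - z))\<^sup>2) \<le> \<mu> / 2 * ((hess f z *v (y - z)) \<bullet> (y - z))"
      using \<mu> c(2) by (intro mult_left_mono) auto
    ultimately have "\<mu> / 2 * (c * (norm (y - z))\<^sup>2) \<le> f x0 - f z" using y by linarith
    then have "(norm (y - z))\<^sup>2 \<le> ?R" using \<mu> c(1) by (simp add: field_simps)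
    then have "norm (y - z) \<le> sqrt ?R" by (rule real_le_rsqrt)
    then show "y \<in> cball z (sqrt ?R)" by (simp add: dist_norm norm_minus_commute)
  qed
  then have "bounded (level_set f x0)" using bounded_cball bounded_subset by blast
  moreover have "closed (level_set f x0)"
    unfolding level_set_def by (intro closed_Collect_le cont continuous_on_const)
  ultimately show ?thesis by (simp add: compact_eq_bounded_closed)
qed

section \<open>The contraction in expectation\<close>

text \<open>
  Iterating the contraction needs \<open>0 \<le> 1 - c\<close>. If \<open>1 - c\<close> is negative and \<open>k > 0\<close>, the inequality
  \<open>0 \<le> e 1 \<le> (1 - c) e 0\<close> forces \<open>e\<close> to vanish up to \<open>k\<close>, so that both bounds still hold.
\<close>

lemma linear_contraction_bound:
  fixes e :: "nat \<Rightarrow> real"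
  assumes nonneg: "\<And>t. t \<le> k \<Longrightarrow> 0 \<le> e t"
    and contr: "\<And>t. t < k \<Longrightarrow> e (Suc t) \<le> (1 - c) * e t"
  shows "e k \<le> (1 - c) ^ k * e 0"
    and "0 < c \<Longrightarrow> 0 < \<epsilon> \<Longrightarrow> \<epsilon> < 1 \<Longrightarrow> 1 / c * ln (1 / \<epsilon>) \<le> real k \<Longrightarrow> e k \<le> \<epsilon> * e 0"
proof -
  have zero: "e 0 = 0 \<and> e k = 0" if k: "0 < k" and c: "1 - c < 0"
  proof -
    have "e t = 0" if "t \<le> k" for t
      using that
    proof (induction t)
      case 0
      have "0 \<le> e (Suc 0)" by (rule nonneg) (use k in simp)
      also have "\<dots> \<le> (1 - c) * e 0" by (rule contr[OF k])
      finally have "e 0 \<le> 0" using c by (simp add: zero_le_mult_iff)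
      then show ?case using nonneg[of 0] by simp
    next
      case (Suc t)
      then have "e t = 0" by simp
      with contr[of t] Suc.prems have "e (Suc t) \<le> 0" by simp
      then show ?case using nonneg[OF Suc.prems] by simp
    qed
    then show ?thesis by simp
  qed
  have pow: "e t \<le> (1 - c) ^ t * e 0" if "0 \<le> 1 - c" "t \<le> k" for t
    using that(2)
  proof (induction t)
    case (Suc t)
    have "e (Suc t) \<le> (1 - c) * e t" by (rule contr) (use Suc.prems in simp)
    also have "\<dots> \<le> (1 - c) * ((1 - c) ^ t * e 0)"
      by (rule mult_left_mono[OF Suc.IH that(1)]) (use Suc.prems in simp)
    finally show ?case by (simp only: mult.assoc power_Suc)
  qed simp
  show "e k \<le> (1 - c) ^ k * e 0"
  proof (cases "0 \<le> 1 - c")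
    case False
    then show ?thesis using zero by (cases "k = 0") simp_all
  qed (rule pow, simp_all)
  show "e k \<le> \<epsilon> * e 0" if c: "0 < c" and \<epsilon>: "0 < \<epsilon>" "\<epsilon> < 1" and k: "1 / c * ln (1 / \<epsilon>) \<le> real k"
  proof (cases "0 \<le> 1 - c")
    case True
    have "(1 - c) ^ k \<le> exp (- c) ^ k"
      by (rule power_mono[OF _ True]) (use exp_ge_add_one_self[of "- c"] in simp)
    also have "\<dots> = exp (real k * (- c))" by (rule exp_of_nat_mult[symmetric])
    also have "\<dots> \<le> exp (- ln (1 / \<epsilon>))"
    proof -
      have "ln (1 / \<epsilon>) = c * (1 / c * ln (1 / \<epsilon>))" using c by simp
      also have "\<dots> \<le> c * real k" by (rule mult_left_mono[OF k less_imp_le[OF c]])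
      finally have "ln (1 / \<epsilon>) \<le> real k * c" by (simp only: mult.commute)
      then show ?thesis by (simp only: exp_le_cancel_iff mult_minus_right neg_le_iff_le)
    qed
    also have "\<dots> = \<epsilon>" using \<epsilon> by (simp add: ln_div)
    finally have "(1 - c) ^ k * e 0 \<le> \<epsilon> * e 0" by (rule mult_right_mono) (rule nonneg, simp)
    with pow[OF True order_refl] show ?thesis by (rule order_trans)
  next
    case False
    have "0 < 1 / c * ln (1 / \<epsilon>)" using c \<epsilon> by simp
    from less_le_trans[OF this k] have "0 < k" by simp
    moreover have "1 - c < 0" using False by simp
    ultimately have "e 0 = 0" "e k = 0" using zero by blast+
    then show ?thesis by simp
  qed
qed

lemma sgn_iter_cong:
  assumes "\<And>i. i < k \<Longrightarrow> s i = s' i"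
  shows "sgn_iter L f x0 s k = sgn_iter L f x0 s' k"
  using assms
proof (induction k)
  case (Suc k)
  have "sgn_iter L f x0 s k = sgn_iter L f x0 s' k" by (rule Suc.IH) (rule Suc.prems, simp)
  then show ?case by (simp add: Suc.prems)
qed simp

context sketched_newton begin

lemma measurable_sgn_iter:
  assumes "{..<k} \<subseteq> I"
  shows "(\<lambda>s. sgn_iter Lalg f x0 s k) \<in> borel_measurable (PiM I (\<lambda>_. borel))"
  using assms
proof (induction k)
  case (Suc k)
  then have "k \<in> I" and I: "{..<k} \<subseteq> I" by auto
  show ?case
    unfolding sgn_iter.simps
    by (rule measurable_sgn_step[OF Suc.IH[OF I] measurable_component_singleton[OF \<open>k \<in> I\<close>]])
qed simp

lemma measurable_iterate:
  assumes "\<And>i. S i \<in> measurable P borel"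
  shows "(\<lambda>\<omega>. sgn_iter Lalg f x0 (\<lambda>i. S i \<omega>) k) \<in> borel_measurable P"
proof (induction k)
  case (Suc k)
  show ?case unfolding sgn_iter.simps by (rule measurable_sgn_step[OF Suc.IH assms])
qed simp

text \<open>
  The iterate is a function of the sketches drawn before step \<open>k\<close>, which are independent of the one
  drawn at step \<open>k\<close>; by Fubini the latter may be averaged first.
\<close>

lemma nn_integral_iterate_sketch:
  assumes P: "prob_space P" and indep: "prob_space.indep_vars P (\<lambda>_. borel) S UNIV"
    and distr: "distr P borel (S k) = D"
    and F: "F \<in> borel_measurable (borel \<Otimes>\<^sub>M borel)"
  shows "(\<integral>\<^sup>+\<omega>. F (sgn_iter Lalg f x0 (\<lambda>i. S i \<omega>) k, S k \<omega>) \<partial>P) =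
    (\<integral>\<^sup>+\<omega>. \<integral>\<^sup>+T. F (sgn_iter Lalg f x0 (\<lambda>i. S i \<omega>) k, T) \<partial>D \<partial>P)"
proof -
  interpret P: prob_space P by fact
  let ?X = "\<lambda>\<omega>. sgn_iter Lalg f x0 (\<lambda>i. S i \<omega>) k"
  let ?A = "PiM {..<k} (\<lambda>_. borel :: 'd sketch measure)" and ?B = "PiM {k} (\<lambda>_. borel :: 'd sketch measure)"
  let ?R = "\<lambda>\<omega>. restrict (\<lambda>i. S i \<omega>) {..<k}" and ?R' = "\<lambda>\<omega>. restrict (\<lambda>i. S i \<omega>) {k}"
  \<comment> \<open>the past and the new sketch are both kept as restricted families, so that the two independent
    random variables have the same type\<close>
  define G where "G = (\<lambda>(r, r'). F (sgn_iter Lalg f x0 r k, r' k))"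
  have S: "S k \<in> measurable P borel" using indep by (simp add: P.indep_vars_def)
  have "P.indep_var ?A ?R ?B ?R'"
    by (rule P.indep_var_restrict[OF indep]) auto
  then have R: "?R \<in> measurable P ?A" and R': "?R' \<in> measurable P ?B"
    and joint: "distr P ?A ?R \<Otimes>\<^sub>M distr P ?B ?R' = distr P (?A \<Otimes>\<^sub>M ?B) (\<lambda>\<omega>. (?R \<omega>, ?R' \<omega>))"
    unfolding P.indep_var_distribution_eq by blast+
  have r: "(\<lambda>p. sgn_iter Lalg f x0 (fst p) k) \<in> borel_measurable (?A \<Otimes>\<^sub>M ?B)"
    by (rule measurable_compose[OF measurable_fst measurable_sgn_iter[OF order_refl]])
  have r': "(\<lambda>p. snd p k) \<in> measurable (?A \<Otimes>\<^sub>M ?B) borel"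
    by (rule measurable_compose[OF measurable_snd measurable_component_singleton]) simp
  have G: "G \<in> borel_measurable (?A \<Otimes>\<^sub>M ?B)"
    unfolding G_def case_prod_beta by (rule measurable_compose[OF measurable_Pair[OF r r'] F])
  have G_R: "G (?R \<omega>, ?R' \<omega>') = F (?X \<omega>, S k \<omega>')" for \<omega> \<omega>'
    unfolding G_def using sgn_iter_cong[of k "?R \<omega>" "\<lambda>i. S i \<omega>" Lalg f x0] by simp
  interpret R': prob_space "distr P ?B ?R'" by (rule P.prob_space_distr[OF R'])
  have G_joint: "G \<in> borel_measurable (distr P ?A ?R \<Otimes>\<^sub>M distr P ?B ?R')"
    using G by (simp add: joint)
  have "(\<integral>\<^sup>+\<omega>. F (?X \<omega>, S k \<omega>) \<partial>P) = (\<integral>\<^sup>+p. G p \<partial>distr P (?A \<Otimes>\<^sub>M ?B) (\<lambda>\<omega>. (?R \<omega>, ?R' \<omega>)))"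
    unfolding G_R[symmetric] by (rule nn_integral_distr[OF measurable_Pair[OF R R'], symmetric]) (use G in simp)
  also have "\<dots> = (\<integral>\<^sup>+r. \<integral>\<^sup>+r'. G (r, r') \<partial>distr P ?B ?R' \<partial>distr P ?A ?R)"
    unfolding joint[symmetric] by (rule R'.nn_integral_fst[OF G_joint, symmetric])
  also have "\<dots> = (\<integral>\<^sup>+\<omega>. \<integral>\<^sup>+r'. G (?R \<omega>, r') \<partial>distr P ?B ?R' \<partial>P)"
    by (rule nn_integral_distr[OF R]) (use R'.borel_measurable_nn_integral_fst[OF G_joint] in simp)
  also have "\<dots> = (\<integral>\<^sup>+\<omega>. \<integral>\<^sup>+T. F (?X \<omega>, T) \<partial>D \<partial>P)"
  proof (rule nn_integral_cong)
    fix \<omega> assume "\<omega> \<in> space P"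
    then have "?R \<omega> \<in> space ?A" by (rule measurable_space[OF R])
    then have G1: "(\<lambda>r'. G (?R \<omega>, r')) \<in> borel_measurable ?B"
      by (rule measurable_compose[OF measurable_Pair1' G])
    have "(\<integral>\<^sup>+r'. G (?R \<omega>, r') \<partial>distr P ?B ?R') = (\<integral>\<^sup>+\<omega>'. F (?X \<omega>, S k \<omega>') \<partial>P)"
      unfolding G_R[symmetric] by (rule nn_integral_distr[OF R']) (use G1 in simp)
    also have "\<dots> = (\<integral>\<^sup>+T. F (?X \<omega>, T) \<partial>D)"
    proof -
      have "(\<lambda>T. F (?X \<omega>, T)) \<in> borel_measurable borel"
        by (rule measurable_compose[OF measurable_Pair1' F]) simp
      then show ?thesis
        unfolding distr[symmetric] by (intro nn_integral_distr[OF S, symmetric]) simp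
    qed
    finally show "(\<integral>\<^sup>+r'. G (?R \<omega>, r') \<partial>distr P ?B ?R') = (\<integral>\<^sup>+T. F (?X \<omega>, T) \<partial>D)" .
  qed
  finally show ?thesis .
qed

lemma nn_integral_step_energy:
  "(\<integral>\<^sup>+T. ennreal (step x T * energy x g T) \<partial>D) = ennreal (mean_energy x g)"
  unfolding mean_energy_def
  by (intro nn_integral_eq_integral integrable_step_energy AE_I2 step_energy_nonneg)

text \<open>
  Averaged over the new sketch, the decrease is at least \<open>2 / 3\<close> times the mean energy of the
  gradient. This is at least \<open>2 / 3 \<rho>\<close> times its squared full dual norm and thus at least
  \<open>4 / 3 \<rho> \<mu>\<close> times the gap. Since the values decrease along the iteration, the iterates remain in the
  level set, where \<open>\<rho>\<close> is a lower bound for the quotient.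
\<close>

lemma expected_gap:
  assumes P: "prob_space P" and indep: "prob_space.indep_vars P (\<lambda>_. borel) S UNIV"
    and distr: "\<And>k. distr P borel (S k) = D"
    and f_cont: "continuous_on UNIV f" and f_min: "\<And>y. f xstar \<le> f y"
    and compact: "compact (level_set f x0)"
    and gap: "\<And>x. 2 * \<mu> * (f x - f xstar) \<le> full_energy x (grad f x)"
    and rho: "0 \<le> rho_min Lalg f D x0" and \<mu>: "0 \<le> \<mu>"
    and decrease: "AE \<omega> in P. \<forall>t<k. f (sgn_iter Lalg f x0 (\<lambda>i. S i \<omega>) (Suc t)) \<le>
      f (sgn_iter Lalg f x0 (\<lambda>i. S i \<omega>) t) -
      2 / 3 * (step (sgn_iter Lalg f x0 (\<lambda>i. S i \<omega>) t) (S t \<omega>) *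
        energy (sgn_iter Lalg f x0 (\<lambda>i. S i \<omega>) t) (grad f (sgn_iter Lalg f x0 (\<lambda>i. S i \<omega>) t)) (S t \<omega>))"
  shows "t \<le> k \<Longrightarrow> integrable P (\<lambda>\<omega>. f (sgn_iter Lalg f x0 (\<lambda>i. S i \<omega>) t) - f xstar)"
    and "t < k \<Longrightarrow> (\<integral>\<omega>. f (sgn_iter Lalg f x0 (\<lambda>i. S i \<omega>) (Suc t)) - f xstar \<partial>P) \<le>
      (1 - 4 / 3 * rho_min Lalg f D x0 * \<mu>) *
      (\<integral>\<omega>. f (sgn_iter Lalg f x0 (\<lambda>i. S i \<omega>) t) - f xstar \<partial>P)"
proof -
  interpret P: prob_space P by fact
  define X where "X = (\<lambda>t \<omega>. sgn_iter Lalg f x0 (\<lambda>i. S i \<omega>) t)"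
  define d where "d = (\<lambda>t \<omega>. step (X t \<omega>) (S t \<omega>) * energy (X t \<omega>) (grad f (X t \<omega>)) (S t \<omega>))"
  let ?\<rho> = "rho_min Lalg f D x0" and ?B = "f x0 - f xstar"
  have dec: "AE \<omega> in P. \<forall>t<k. f (X (Suc t) \<omega>) \<le> f (X t \<omega>) - 2 / 3 * d t \<omega>"
    using decrease unfolding X_def d_def .
  have d_nonneg: "0 \<le> d t \<omega>" for t \<omega> unfolding d_def by (rule step_energy_nonneg)
  have S: "S t \<in> measurable P borel" for t using indep by (simp add: P.indep_vars_def)
  have X: "X t \<in> borel_measurable P" for t unfolding X_def by (rule measurable_iterate[OF S])
  have fX: "(\<lambda>\<omega>. f (X t \<omega>)) \<in> borel_measurable P" for t
    by (rule measurable_compose[OF X borel_measurable_continuous_onI[OF f_cont]])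
  have level: "AE \<omega> in P. f (X t \<omega>) \<le> f x0" if "t \<le> k" for t
    using dec
  proof eventually_elim
    case (elim \<omega>)
    from that show ?case
    proof (induction t)
      case (Suc t)
      then show ?case using elim[rule_format, of t] d_nonneg[of t \<omega>] by simp
    qed (simp add: X_def)
  qed
  have int: "integrable P (\<lambda>\<omega>. f (X t \<omega>) - f xstar)" if "t \<le> k" for t
  proof (rule P.integrable_const_bound)
    show "AE \<omega> in P. norm (f (X t \<omega>) - f xstar) \<le> ?B"
      using level[OF that]
    proof eventually_elim
      case (elim \<omega>)
      then show ?case using f_min[of "X t \<omega>"] by simp
    qed
  qed (intro borel_measurable_diff fX borel_measurable_const)
  then show "t \<le> k \<Longrightarrow> integrable P (\<lambda>\<omega>. f (sgn_iter Lalg f x0 (\<lambda>i. S i \<omega>) t) - f xstar)"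
    unfolding X_def .
  have "(\<integral>\<omega>. f (X (Suc t) \<omega>) - f xstar \<partial>P) \<le> (1 - 4 / 3 * ?\<rho> * \<mu>) * (\<integral>\<omega>. f (X t \<omega>) - f xstar \<partial>P)"
    if t: "t < k"
  proof -
    note int0 = int[OF less_imp_le[OF t]] and int1 = int[OF Suc_leI[OF t]]
    have d_meas: "d t \<in> borel_measurable P"
      unfolding d_def[abs_def]
      by (intro borel_measurable_times measurable_step measurable_energy measurable_grad X S)
    \<comment> \<open>the value cannot drop below the minimum, which bounds \<open>d t\<close> by \<open>3 / 2\<close> of the initial gap\<close>
    have d_int: "integrable P (d t)"
    proof (rule P.integrable_const_bound[OF _ d_meas])
      show "AE \<omega> in P. norm (d t \<omega>) \<le> 3 / 2 * ?B"
        using dec level[OF less_imp_le[OF t]]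
      proof eventually_elim
        case (elim \<omega>)
        then have "f (X (Suc t) \<omega>) \<le> f (X t \<omega>) - 2 / 3 * d t \<omega>" "f (X t \<omega>) \<le> f x0"
          using t by auto
        then show ?case using f_min[of "X (Suc t) \<omega>"] d_nonneg[of t \<omega>] by simp
      qed
    qed
    have "(\<integral>\<omega>. f (X (Suc t) \<omega>) - f xstar \<partial>P) \<le> (\<integral>\<omega>. (f (X t \<omega>) - f xstar) - 2 / 3 * d t \<omega> \<partial>P)"
    proof (rule integral_mono_AE)
      show "AE \<omega> in P. f (X (Suc t) \<omega>) - f xstar \<le> (f (X t \<omega>) - f xstar) - 2 / 3 * d t \<omega>"
        using dec by eventually_elim (use t in force)
    qed (intro int1 Bochner_Integration.integrable_diff int0 integrable_mult_right d_int)+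
    also have "\<dots> = (\<integral>\<omega>. f (X t \<omega>) - f xstar \<partial>P) - 2 / 3 * (\<integral>\<omega>. d t \<omega> \<partial>P)"
      using int0 d_int by simp
    finally have 1: "(\<integral>\<omega>. f (X (Suc t) \<omega>) - f xstar \<partial>P) \<le>
        (\<integral>\<omega>. f (X t \<omega>) - f xstar \<partial>P) - 2 / 3 * (\<integral>\<omega>. d t \<omega> \<partial>P)" .
    have "ennreal (2 * ?\<rho> * \<mu> * (\<integral>\<omega>. f (X t \<omega>) - f xstar \<partial>P)) =
        ennreal (\<integral>\<omega>. 2 * ?\<rho> * \<mu> * (f (X t \<omega>) - f xstar) \<partial>P)" by simp
    also have "\<dots> = (\<integral>\<^sup>+\<omega>. ennreal (2 * ?\<rho> * \<mu> * (f (X t \<omega>) - f xstar)) \<partial>P)"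
      using rho \<mu> f_min
      by (intro nn_integral_eq_integral[symmetric] integrable_mult_right int0 AE_I2) auto
    also have "\<dots> \<le> (\<integral>\<^sup>+\<omega>. ennreal (mean_energy (X t \<omega>) (grad f (X t \<omega>))) \<partial>P)"
    proof (rule nn_integral_mono_AE)
      show "AE \<omega> in P. ennreal (2 * ?\<rho> * \<mu> * (f (X t \<omega>) - f xstar)) \<le>
          ennreal (mean_energy (X t \<omega>) (grad f (X t \<omega>)))"
        using level[OF less_imp_le[OF t]]
      proof eventually_elim
        case (elim \<omega>)
        have "2 * ?\<rho> * \<mu> * (f (X t \<omega>) - f xstar) = ?\<rho> * (2 * \<mu> * (f (X t \<omega>) - f xstar))" by simp
        also have "\<dots> \<le> ?\<rho> * full_energy (X t \<omega>) (grad f (X t \<omega>))"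
          by (rule mult_left_mono[OF gap rho])
        also have "\<dots> \<le> mean_energy (X t \<omega>) (grad f (X t \<omega>))"
          using elim by (intro rho_min_mean_energy[OF compact]) (simp add: level_set_def)
        finally show ?case by (rule ennreal_leI)
      qed
    qed
    also have "\<dots> = (\<integral>\<^sup>+\<omega>. \<integral>\<^sup>+T. ennreal (step (X t \<omega>) T * energy (X t \<omega>) (grad f (X t \<omega>)) T) \<partial>D \<partial>P)"
      unfolding nn_integral_step_energy ..
    also have "\<dots> = (\<integral>\<^sup>+\<omega>. ennreal (d t \<omega>) \<partial>P)"
    proof -
      have "(\<lambda>p. ennreal (step (fst p) (snd p) * energy (fst p) (grad f (fst p)) (snd p)))
          \<in> borel_measurable (borel \<Otimes>\<^sub>M borel)"
        by (intro measurable_compose[OF _ measurable_ennreal] borel_measurable_times measurable_step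
            measurable_energy measurable_grad measurable_fst measurable_snd)
      from nn_integral_iterate_sketch[OF P indep distr this, of x0 t]
      show ?thesis by (simp add: X_def d_def)
    qed
    also have "\<dots> = ennreal (\<integral>\<omega>. d t \<omega> \<partial>P)"
      by (intro nn_integral_eq_integral d_int AE_I2 d_nonneg)
    finally have "2 * ?\<rho> * \<mu> * (\<integral>\<omega>. f (X t \<omega>) - f xstar \<partial>P) \<le> (\<integral>\<omega>. d t \<omega> \<partial>P)"
      using d_nonneg by (subst (asm) ennreal_le_iff) (auto intro: integral_nonneg_AE)
    with 1 show ?thesis by (simp add: algebra_simps)
  qed
  then show "t < k \<Longrightarrow> (\<integral>\<omega>. f (sgn_iter Lalg f x0 (\<lambda>i. S i \<omega>) (Suc t)) - f xstar \<partial>P) \<le>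
      (1 - 4 / 3 * ?\<rho> * \<mu>) * (\<integral>\<omega>. f (sgn_iter Lalg f x0 (\<lambda>i. S i \<omega>) t) - f xstar \<partial>P)"
    unfolding X_def .
qed

end

section \<open>Linear convergence\<close>

theorem theorem4:
  fixes f :: "real^'d \<Rightarrow> real"
    and xstar x0 :: "real^'d"
    and D :: "'d sketch measure"
    and L Lhat :: "'d sketch \<Rightarrow> real"
    and \<mu> Lalg :: real
    and M :: "'w measure"
    and S :: "nat \<Rightarrow> 'w \<Rightarrow> 'd sketch"
  assumes f_convex: "convex_on UNIV f"
    and f_smooth: "three_times_differentiable f"
    and f_hess: "\<And>x. pos_def (hess f x)"
    and f_min: "\<And>y. f xstar \<le> f y"
    and D_prob: "prob_space D"
    and D_sets: "sets D = sets borel"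
    and D_sketch: "AE T in D. T \<in> sketches"
    and rel_smooth: "\<And>T. T \<in> sk_support D \<Longrightarrow> relatively_smooth_in f T (Lhat T)"
    and rel_convex: "relatively_convex f \<mu>"
    and self_conc: "\<And>T. T \<in> sk_support D \<Longrightarrow> self_concordant_in f T (L T)"
    and null_cond: "\<And>T x. T \<in> sk_support D \<Longrightarrow> mat_kernel (sk_hess f T x) = sk_null T"
    and outer_int: "integrable D sk_outer"
    and range_cond: "\<And>x. range (\<lambda>v. hess f x *v v) \<subseteq> range (\<lambda>v. integral\<^sup>L D sk_outer *v v)"
    and Lalg_bdd: "bdd_above ((\<lambda>T. 9 / 2 * L T * (Lhat T)\<^sup>2) ` sk_support D)"
    and Lalg_eq: "Lalg = (SUP T \<in> sk_support D. 9 / 2 * L T * (Lhat T)\<^sup>2)"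
    and M_prob: "prob_space M"
    and S_indep: "prob_space.indep_vars M (\<lambda>_. borel) S UNIV"
    and S_distr: "\<And>k. distr M borel (S k) = D"
  shows "0 < rho_min Lalg f D x0 \<and> rho_min Lalg f D x0 \<le> 1 \<and>
    (\<forall>k. (AE \<omega> in M. \<forall>t\<le>k.
            sk_dual_norm f (S t \<omega>) (sgn_iter Lalg f x0 (\<lambda>i. S i \<omega>) t)
              (sk_grad f (S t \<omega>) (sgn_iter Lalg f x0 (\<lambda>i. S i \<omega>) t))
            \<ge> 1 / L (S t \<omega>)) \<longrightarrow>
       integrable M (\<lambda>\<omega>. f (sgn_iter Lalg f x0 (\<lambda>i. S i \<omega>) k) - f xstar) \<and>
       (\<integral>\<omega>. f (sgn_iter Lalg f x0 (\<lambda>i. S i \<omega>) k) - f xstar \<partial>M)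
         \<le> (1 - 4 / 3 * rho_min Lalg f D x0 * \<mu>) ^ k * (f x0 - f xstar) \<and>
       (\<forall>\<epsilon>. 0 < \<epsilon> \<and> \<epsilon> < 1 \<and>
            real k \<ge> 3 / 4 * (1 / (rho_min Lalg f D x0 * \<mu>)) * ln (1 / \<epsilon>) \<longrightarrow>
          (\<integral>\<omega>. f (sgn_iter Lalg f x0 (\<lambda>i. S i \<omega>) k) - f xstar \<partial>M)
            \<le> \<epsilon> * (f x0 - f xstar)))"
proof -
  have f_diff: "f differentiable (at x)" and f_cont: "continuous_on UNIV f"
    and grad_cont: "continuous_on UNIV (grad f)" and hess_cont: "continuous_on UNIV (hess f)" for x
    using f_smooth differentiable_imp_continuous_within
    unfolding three_times_differentiable_def continuous_on_eq_continuous_within by blast+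
  have \<mu>: "0 < \<mu>" by (rule relatively_convexD(1)[OF f_hess rel_convex])
  have Lalg_ge: "9 / 2 * L T * (Lhat T)\<^sup>2 \<le> Lalg" if "T \<in> sk_support D" for T
    unfolding Lalg_eq using that by (intro cSUP_upper Lalg_bdd)
  have L_pos: "0 < L T" if "T \<in> sk_support D" for T
    using self_conc[OF that] by (simp add: self_concordant_in_def)
  interpret D: prob_space D by fact
  interpret M: prob_space M by fact
  have support: "AE T in D. T \<in> sk_support D" by (rule AE_sk_support[OF D_sets])
  \<comment> \<open>the parameter is a supremum over the support, so its sign needs a point of the support\<close>
  have "sk_support D \<noteq> {}"
  proof
    assume "sk_support D = {}"
    with support have "AE T in D. False" by simp
    then show False by simp
  qed
  then obtain T where T: "T \<in> sk_support D" by blast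
  have "0 \<le> 9 / 2 * L T * (Lhat T)\<^sup>2" using L_pos[OF T] by simp
  then have Lalg: "0 \<le> Lalg" using Lalg_ge[OF T] by linarith
  have outer: "(sk_outer :: 'd sketch \<Rightarrow> _) \<in> borel_measurable borel"
    using borel_measurable_integrable[OF outer_int] measurable_cong_sets[OF D_sets refl] by blast
  interpret sketched_newton f D Lalg
    by unfold_locales (fact f_hess hess_cont grad_cont D_sets outer Lalg)+
  have "grad f xstar = 0" by (rule grad_eq_0_at_minimum[OF f_diff f_min])
  then have compact: "compact (level_set f x0)"
    by (rule compact_level_set[OF f_cont f_hess rel_convex])
  have rho: "0 < rho_min Lalg f D x0" by (rule rho_min_pos[OF compact outer_int range_cond])
  have S: "S t \<in> measurable M borel" for t using S_indep by (simp add: M.indep_vars_def)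
  have S_support: "AE \<omega> in M. \<forall>t. S t \<omega> \<in> sk_support D"
  proof (subst AE_all_countable, rule allI)
    show "AE \<omega> in M. S t \<omega> \<in> sk_support D" for t
      by (rule AE_distrD[OF S]) (simp only: S_distr support)
  qed
  have "integrable M (\<lambda>\<omega>. f (sgn_iter Lalg f x0 (\<lambda>i. S i \<omega>) k) - f xstar) \<and>
       (\<integral>\<omega>. f (sgn_iter Lalg f x0 (\<lambda>i. S i \<omega>) k) - f xstar \<partial>M)
         \<le> (1 - 4 / 3 * rho_min Lalg f D x0 * \<mu>) ^ k * (f x0 - f xstar) \<and>
       (\<forall>\<epsilon>. 0 < \<epsilon> \<and> \<epsilon> < 1 \<and>
            real k \<ge> 3 / 4 * (1 / (rho_min Lalg f D x0 * \<mu>)) * ln (1 / \<epsilon>) \<longrightarrow>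
          (\<integral>\<omega>. f (sgn_iter Lalg f x0 (\<lambda>i. S i \<omega>) k) - f xstar \<partial>M)
            \<le> \<epsilon> * (f x0 - f xstar))"
    if large: "AE \<omega> in M. \<forall>t\<le>k.
      sk_dual_norm f (S t \<omega>) (sgn_iter Lalg f x0 (\<lambda>i. S i \<omega>) t)
        (sk_grad f (S t \<omega>) (sgn_iter Lalg f x0 (\<lambda>i. S i \<omega>) t)) \<ge> 1 / L (S t \<omega>)" for k
  proof -
    define e where "e t = (\<integral>\<omega>. f (sgn_iter Lalg f x0 (\<lambda>i. S i \<omega>) t) - f xstar \<partial>M)" for t
    let ?c = "4 / 3 * rho_min Lalg f D x0 * \<mu>"
    have decrease: "AE \<omega> in M. \<forall>t<k. f (sgn_iter Lalg f x0 (\<lambda>i. S i \<omega>) (Suc t)) \<le>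
        f (sgn_iter Lalg f x0 (\<lambda>i. S i \<omega>) t) -
        2 / 3 * (step (sgn_iter Lalg f x0 (\<lambda>i. S i \<omega>) t) (S t \<omega>) *
          energy (sgn_iter Lalg f x0 (\<lambda>i. S i \<omega>) t) (grad f (sgn_iter Lalg f x0 (\<lambda>i. S i \<omega>) t)) (S t \<omega>))"
      using large S_support
    proof eventually_elim
      case (elim \<omega>)
      show ?case
      proof (intro allI impI)
        fix t assume "t < k"
        then have big: "1 / L (S t \<omega>) \<le> sk_dual_norm f (S t \<omega>) (sgn_iter Lalg f x0 (\<lambda>i. S i \<omega>) t)
            (sk_grad f (S t \<omega>) (sgn_iter Lalg f x0 (\<lambda>i. S i \<omega>) t))"
          using elim(1) by simp
        have supp: "S t \<omega> \<in> sk_support D" using elim(2) by blast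
        show "f (sgn_iter Lalg f x0 (\<lambda>i. S i \<omega>) (Suc t)) \<le>
          f (sgn_iter Lalg f x0 (\<lambda>i. S i \<omega>) t) -
          2 / 3 * (step (sgn_iter Lalg f x0 (\<lambda>i. S i \<omega>) t) (S t \<omega>) *
            energy (sgn_iter Lalg f x0 (\<lambda>i. S i \<omega>) t) (grad f (sgn_iter Lalg f x0 (\<lambda>i. S i \<omega>) t)) (S t \<omega>))"
          unfolding sgn_iter.simps
          by (rule sgn_step_decrease[OF f_hess rel_smooth[OF supp] L_pos[OF supp] Lalg_ge[OF supp] big])
      qed
    qed
    note expected = expected_gap[OF M_prob S_indep S_distr f_cont f_min compact
        relatively_convex_gap[OF f_hess rel_convex] less_imp_le[OF rho] less_imp_le[OF \<mu>] decrease]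
    have e_nonneg: "0 \<le> e t" for t
      unfolding e_def by (rule integral_nonneg_AE) (simp add: f_min)
    have contr: "e (Suc t) \<le> (1 - ?c) * e t" if "t < k" for t
      unfolding e_def by (rule expected(2)[OF that])
    have e0: "e 0 = f x0 - f xstar" unfolding e_def by (simp add: M.prob_space)
    have c: "0 < ?c" using rho \<mu> by simp
    have c_inv: "1 / ?c = 3 / 4 * (1 / (rho_min Lalg f D x0 * \<mu>))" by simp
    have "e k \<le> (1 - ?c) ^ k * e 0"
      by (rule linear_contraction_bound(1)[of k e ?c, OF e_nonneg contr])
    moreover have "e k \<le> \<epsilon> * e 0"
      if "0 < \<epsilon>" "\<epsilon> < 1" "3 / 4 * (1 / (rho_min Lalg f D x0 * \<mu>)) * ln (1 / \<epsilon>) \<le> real k" for \<epsilon>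
      using linear_contraction_bound(2)[of k e ?c, OF e_nonneg contr c that(1,2)] that(3)
      unfolding c_inv by blast
    ultimately show ?thesis
      using expected(1)[OF order_refl] unfolding e0 unfolding e_def by blast
  qed
  with rho rho_min_le_1[OF compact] show ?thesis by blast
qed

end
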